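(* Let $\acute N$ be a screen transversal anti-invariant lightlike submanifold of a locally metallic semi-Riemannian manifold $(\breve N,\breve g,\breve J)$. Then the screen distribution $S(T\acute N)$ defines a totally geodesic foliation if and only if, for all $W,U\in\Gamma(S(T\acute N))$, there is no component of $\nabla^s_W\breve JU-p\,h^s(W,U)$ in $\breve J\,ltr(T\acute N)$.
   Context: Fix positive integers $p,q$. A metallic semi-Riemannian manifold $(\breve N,\breve g,\breve J)$ is a semi-Riemannian manifold $(\breve N,\breve g)$ with a $(1,1)$-tensor field $\breve J$ such that $\breve J^2=p\breve J+qI$ and $\breve g(\breve JW,U)=\breve g(W,\breve JU)$ for all vector fields $W,U$ on $\breve N$. It is locally metallic if $\breve\nabla\breve J=0$, where $\breve\nabla$ is the Levi-Civita connection of $\breve g$. A submanifold $\acute N$ of dimension $m$ in $\breve N$ is lightlike if the metric $g$ induced from $\breve g$ is degenerate and $Rad(T\acute N)=T\acute N\cap T\acute N^{\perp}$ is a distribution of constant rank $r$, $1\le r\le m$. Fix a screen distribution $S(T\acute N)$ (non-degenerate complement of $Rad(T\acute N)$ in $T\acute N$), a screen transversal bundle $S(T\acute N^{\perp})$ (non-degenerate complement of $Rad(T\acute N)$ in $T\acute N^{\perp}$), and the associated lightlike transversal bundle $ltr(T\acute N)$: it is orthogonal to $S(T\acute N)$ and $S(T\acute N^\perp)$, and for any local basis $\{\xi_i\}$ of $Rad(T\acute N)$ it is locally spanned by $\{N_i\}$ with $\breve g(\xi_i,N_j)=\delta_{ij}$, $\breve g(N_i,N_j)=0$. With $\oplus_{ort}$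 denoting orthogonal direct sum, $T\breve N|_{\acute N}=S(T\acute N)\oplus_{ort}[Rad(T\acute N)\oplus ltr(T\acute N)]\oplus_{ort}S(T\acute N^{\perp})$. For $W,U\in\Gamma(T\acute N)$ and $Z\in\Gamma(S(T\acute N^\perp))$ write $\breve\nabla_WU=\nabla_WU+h^{\ell}(W,U)+h^s(W,U)$ and $\breve\nabla_WZ=-A_ZW+\nabla^s_WZ+D^{\ell}(W,Z)$, where $\nabla_WU,A_ZW\in\Gamma(T\acute N)$, $h^\ell(W,U),D^\ell(W,Z)\in\Gamma(ltr(T\acute N))$ and $h^s(W,U),\nabla^s_WZ\in\Gamma(S(T\acute N^\perp))$. The screen distribution defines a totally geodesic foliation if $\nabla_WU\in\Gamma(S(T\acute N))$ for all $W,U\in\Gamma(S(T\acute N))$, equivalently $\breve g(\nabla_WU,N)=0$ for all such $W,U$ and all $N\in\Gamma(ltr(T\acute N))$. $\acute N$ is screen transversal anti-invariant if $\breve J\,Rad(T\acute N)\subset S(T\acute N^{\perp})$ and $\breve J\,S(T\acute N)\subset S(T\acute N^{\perp})$. Throughout, $\breve J\,ltr(T\acute N)\subset S(T\acute N^\perp)$ as well, and $S(T\acute N^\perp)=\{\breve J Rad(T\acute N)\oplus\breve J\,ltr(T\acute N)\oplus\breve J S(T\acute N)\}\oplus_{ort}D_o$, where $D_o$ is the non-degenerate orthogonal complement. A section $X$ is said to have no component in $\breve J\,ltr(T\acute N)$ if $\breve g(X,\breve JN)=0$ for all $N\in\Gamma(ltr(T\acute N))$. *)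

theory Defs
  imports "HOL-Analysis.Analysis"
begin

section \<open>Smooth maps between Euclidean spaces\<close>

text \<open>
  \<open>k\<close>-fold continuous differentiability on an open set: in finite dimension it suffices that all
  directional derivatives are \<open>k - 1\<close> times continuously differentiable.
\<close>

primrec Ck_on :: "nat \<Rightarrow> 'a::euclidean_space set \<Rightarrow> ('a \<Rightarrow> 'b::euclidean_space) \<Rightarrow> bool" where
  "Ck_on 0 S f \<longleftrightarrow> continuous_on S f"
| "Ck_on (Suc k) S f \<longleftrightarrow>
     (\<forall>x\<in>S. f differentiable (at x)) \<and> (\<forall>v. Ck_on k S (\<lambda>x. frechet_derivative f (at x) v))"

definition smooth_on :: "'a::euclidean_space set \<Rightarrow> ('a \<Rightarrow> 'b::euclidean_space) \<Rightarrow> bool" where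
  "smooth_on S f \<longleftrightarrow> (\<forall>k. Ck_on k S f)"


section \<open>Smooth manifolds and tangent vectors\<close>

text \<open>
  A manifold is a Hausdorff second countable space (the whole type \<open>'m\<close>) with a smooth atlas
  modelled on \<open>'e\<close>; its dimension is \<open>DIM('e)\<close>. A chart is a pair (domain, coordinate map).
  The atlas need not be maximal: it determines the smooth structure.
\<close>

type_synonym ('m, 'e) chart = "'m set \<times> ('m \<Rightarrow> 'e)"

definition cinv :: "('m, 'e) chart \<Rightarrow> 'e \<Rightarrow> 'm" where
  "cinv c = inv_into (fst c) (snd c)"

definition is_chart :: "('m::topological_space, 'e::euclidean_space) chart \<Rightarrow> bool" where
  "is_chart c \<longleftrightarrow> open (fst c) \<and> open (snd c ` fst c) \<and>
     homeomorphism (fst c) (snd c ` fst c) (snd c) (cinv c)"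

definition smooth_atlas :: "('m::topological_space, 'e::euclidean_space) chart set \<Rightarrow> bool" where
  "smooth_atlas A \<longleftrightarrow> (\<forall>c\<in>A. is_chart c) \<and> \<Union>(fst ` A) = UNIV \<and>
     (\<forall>c\<in>A. \<forall>d\<in>A. smooth_on (snd c ` (fst c \<inter> fst d)) (snd d \<circ> cinv c))"

text \<open>
  Tangent vectors: one chart around each point is singled out, and the tangent space at \<open>x\<close> is the
  model space \<open>'e\<close>, a vector being identified with its coordinates in the chart \<open>chart_at A x\<close>.
  Its coordinates in any other chart are obtained by the transformation law \<open>tcoord\<close>.
  So a vector field is a function \<open>'m \<Rightarrow> 'e\<close>, but, the chosen chart varying with the point, its
  smoothness has to be read off in the coordinates of one fixed chart.
\<close>

definition chart_at :: "('m, 'e) chart set \<Rightarrow> 'm \<Rightarrow> ('m, 'e) chart" where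
  "chart_at A x = (SOME c. c \<in> A \<and> x \<in> fst c)"

definition tcoord ::
  "('m, 'e::euclidean_space) chart set \<Rightarrow> ('m, 'e) chart \<Rightarrow> 'm \<Rightarrow> 'e \<Rightarrow> 'e" where
  "tcoord A c x v =
     frechet_derivative (snd c \<circ> cinv (chart_at A x)) (at (snd (chart_at A x) x)) v"

definition smooth_fun_on ::
  "('m, 'e::euclidean_space) chart set \<Rightarrow> 'm set \<Rightarrow> ('m \<Rightarrow> real) \<Rightarrow> bool" where
  "smooth_fun_on A \<Omega> f \<longleftrightarrow> (\<forall>c\<in>A. smooth_on (snd c ` (fst c \<inter> \<Omega>)) (f \<circ> cinv c))"

definition dir_deriv ::
  "('m, 'e::euclidean_space) chart set \<Rightarrow> 'm \<Rightarrow> 'e \<Rightarrow> ('m \<Rightarrow> real) \<Rightarrow> real" where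
  "dir_deriv A x v f = frechet_derivative (f \<circ> cinv (chart_at A x)) (at (snd (chart_at A x) x)) v"

definition smooth_map ::
  "('n::topological_space, 'f::euclidean_space) chart set \<Rightarrow>
   ('m::topological_space, 'e::euclidean_space) chart set \<Rightarrow> ('n \<Rightarrow> 'm) \<Rightarrow> bool" where
  "smooth_map B A \<iota> \<longleftrightarrow> continuous_on UNIV \<iota> \<and>
     (\<forall>c\<in>B. \<forall>d\<in>A. smooth_on (snd c ` (fst c \<inter> \<iota> -` fst d)) (snd d \<circ> \<iota> \<circ> cinv c))"

definition tangent_map ::
  "('n, 'f::euclidean_space) chart set \<Rightarrow> ('m, 'e::euclidean_space) chart set \<Rightarrow>
   ('n \<Rightarrow> 'm) \<Rightarrow> 'n \<Rightarrow> 'f \<Rightarrow> 'e" where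
  "tangent_map B A \<iota> x w =
     frechet_derivative (snd (chart_at A (\<iota> x)) \<circ> \<iota> \<circ> cinv (chart_at B x))
       (at (snd (chart_at B x) x)) w"

text \<open>
  Smooth sections over \<open>\<Omega>\<close> of the pull-back bundle \<open>\<iota>\<^sup>*TM\<close>, i.e. vector fields along \<open>\<iota>\<close>:
  \<open>X x\<close> is a tangent vector at \<open>\<iota> x\<close>. For the identity these are the vector fields.
\<close>

definition smooth_along ::
  "('n, 'f::euclidean_space) chart set \<Rightarrow> ('m, 'e::euclidean_space) chart set \<Rightarrow>
   ('n \<Rightarrow> 'm) \<Rightarrow> 'n set \<Rightarrow> ('n \<Rightarrow> 'e) \<Rightarrow> bool" where
  "smooth_along B A \<iota> \<Omega> X \<longleftrightarrow>
     (\<forall>c\<in>B. \<forall>d\<in>A. smooth_on (snd c ` (fst c \<inter> \<Omega> \<inter> \<iota> -` fst d))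
        (\<lambda>y. tcoord A d (\<iota> (cinv c y)) (X (cinv c y))))"

definition smooth_vf_on ::
  "('m, 'e::euclidean_space) chart set \<Rightarrow> 'm set \<Rightarrow> ('m \<Rightarrow> 'e) \<Rightarrow> bool" where
  "smooth_vf_on A \<Omega> X \<longleftrightarrow> smooth_along A A (\<lambda>x. x) \<Omega> X"


section \<open>Metallic semi-Riemannian manifolds\<close>

definition nondegenerate_on :: "('e::real_vector \<Rightarrow> 'e \<Rightarrow> real) \<Rightarrow> 'e set \<Rightarrow> bool" where
  "nondegenerate_on b V \<longleftrightarrow> (\<forall>v\<in>V. (\<forall>w\<in>V. b v w = 0) \<longrightarrow> v = 0)"

definition index_of_form :: "('e::euclidean_space \<Rightarrow> 'e \<Rightarrow> real) \<Rightarrow> nat" where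
  "index_of_form b = Max (dim ` {V. subspace V \<and> (\<forall>v\<in>V. v \<noteq> 0 \<longrightarrow> b v v < 0)})"

text \<open>A tensor field is smooth if it yields smooth results on smooth (local) vector fields.\<close>

definition semi_riemannian_metric ::
  "('m::topological_space, 'e::euclidean_space) chart set \<Rightarrow> ('m \<Rightarrow> 'e \<Rightarrow> 'e \<Rightarrow> real) \<Rightarrow> bool" where
  "semi_riemannian_metric A g \<longleftrightarrow>
     (\<forall>x. bilinear (g x)) \<and> (\<forall>x v w. g x v w = g x w v) \<and> (\<forall>x. nondegenerate_on (g x) UNIV) \<and>
     (\<exists>\<nu>. \<forall>x. index_of_form (g x) = \<nu>) \<and>
     (\<forall>\<Omega> X Y. open \<Omega> \<longrightarrow> smooth_vf_on A \<Omega> X \<longrightarrow> smooth_vf_on A \<Omega> Y \<longrightarrow>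
        smooth_fun_on A \<Omega> (\<lambda>x. g x (X x) (Y x)))"

definition metallic_semi_riemannian ::
  "('m::topological_space, 'e::euclidean_space) chart set \<Rightarrow> ('m \<Rightarrow> 'e \<Rightarrow> 'e \<Rightarrow> real) \<Rightarrow>
   ('m \<Rightarrow> 'e \<Rightarrow> 'e) \<Rightarrow> nat \<Rightarrow> nat \<Rightarrow> bool" where
  "metallic_semi_riemannian A g J p q \<longleftrightarrow>
     smooth_atlas A \<and> semi_riemannian_metric A g \<and>
     (\<forall>x. linear (J x)) \<and>
     (\<forall>\<Omega> X. open \<Omega> \<longrightarrow> smooth_vf_on A \<Omega> X \<longrightarrow> smooth_vf_on A \<Omega> (\<lambda>x. J x (X x))) \<and>
     (\<forall>x v. J x (J x v) = real p *\<^sub>R J x v + real q *\<^sub>R v) \<and>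
     (\<forall>x v w. g x (J x v) w = g x v (J x w))"

text \<open>
  An affine connection, \<open>nabla x v Y\<close> being the covariant derivative at \<open>x\<close> in the direction of the
  tangent vector \<open>v\<close> of a vector field \<open>Y\<close> that is smooth near \<open>x\<close>. Since \<open>f\<close> in the Leibniz rule
  only has to be smooth near \<open>x\<close> (it may be an indicator function), the value depends only on the
  germ of \<open>Y\<close>; values on fields that are not smooth near \<open>x\<close> are irrelevant.
\<close>

definition affine_connection ::
  "('m::topological_space, 'e::euclidean_space) chart set \<Rightarrow>
   ('m \<Rightarrow> 'e \<Rightarrow> ('m \<Rightarrow> 'e) \<Rightarrow> 'e) \<Rightarrow> bool" where
  "affine_connection A nabla \<longleftrightarrow>
     (\<forall>\<Omega> x Y. open \<Omega> \<longrightarrow> x \<in> \<Omega> \<longrightarrow> smooth_vf_on A \<Omega> Y \<longrightarrow> linear (\<lambda>v. nabla x v Y)) \<and>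
     (\<forall>\<Omega> x v Y Z. open \<Omega> \<longrightarrow> x \<in> \<Omega> \<longrightarrow> smooth_vf_on A \<Omega> Y \<longrightarrow> smooth_vf_on A \<Omega> Z \<longrightarrow>
        nabla x v (\<lambda>y. Y y + Z y) = nabla x v Y + nabla x v Z) \<and>
     (\<forall>\<Omega> x v f Y. open \<Omega> \<longrightarrow> x \<in> \<Omega> \<longrightarrow> smooth_fun_on A \<Omega> f \<longrightarrow> smooth_vf_on A \<Omega> Y \<longrightarrow>
        nabla x v (\<lambda>y. f y *\<^sub>R Y y) = dir_deriv A x v f *\<^sub>R Y x + f x *\<^sub>R nabla x v Y) \<and>
     (\<forall>\<Omega> X Y. open \<Omega> \<longrightarrow> smooth_vf_on A \<Omega> X \<longrightarrow> smooth_vf_on A \<Omega> Y \<longrightarrow>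
        smooth_vf_on A \<Omega> (\<lambda>x. nabla x (X x) Y))"

text \<open>
  The torsion condition \<open>\<nabla>\<^sub>XY - \<nabla>\<^sub>YX = [X, Y]\<close> is expressed through the action of both sides on
  functions, using \<open>[X, Y] f = X (Y f) - Y (X f)\<close>.
\<close>

definition levi_civita_connection ::
  "('m::topological_space, 'e::euclidean_space) chart set \<Rightarrow> ('m \<Rightarrow> 'e \<Rightarrow> 'e \<Rightarrow> real) \<Rightarrow>
   ('m \<Rightarrow> 'e \<Rightarrow> ('m \<Rightarrow> 'e) \<Rightarrow> 'e) \<Rightarrow> bool" where
  "levi_civita_connection A g nabla \<longleftrightarrow> affine_connection A nabla \<and>
     (\<forall>\<Omega> x X Y f. open \<Omega> \<longrightarrow> x \<in> \<Omega> \<longrightarrow> smooth_vf_on A \<Omega> X \<longrightarrow> smooth_vf_on A \<Omega> Y \<longrightarrow>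
        smooth_fun_on A \<Omega> f \<longrightarrow>
        dir_deriv A x (nabla x (X x) Y - nabla x (Y x) X) f =
          dir_deriv A x (X x) (\<lambda>y. dir_deriv A y (Y y) f)
          - dir_deriv A x (Y x) (\<lambda>y. dir_deriv A y (X y) f)) \<and>
     (\<forall>\<Omega> x v Y Z. open \<Omega> \<longrightarrow> x \<in> \<Omega> \<longrightarrow> smooth_vf_on A \<Omega> Y \<longrightarrow> smooth_vf_on A \<Omega> Z \<longrightarrow>
        dir_deriv A x v (\<lambda>y. g y (Y y) (Z y)) = g x (nabla x v Y) (Z x) + g x (Y x) (nabla x v Z))"

definition parallel_endomorphism ::
  "('m::topological_space, 'e::euclidean_space) chart set \<Rightarrow>
   ('m \<Rightarrow> 'e \<Rightarrow> ('m \<Rightarrow> 'e) \<Rightarrow> 'e) \<Rightarrow> ('m \<Rightarrow> 'e \<Rightarrow> 'e) \<Rightarrow> bool" where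
  "parallel_endomorphism A nabla J \<longleftrightarrow>
     (\<forall>\<Omega> x v Y. open \<Omega> \<longrightarrow> x \<in> \<Omega> \<longrightarrow> smooth_vf_on A \<Omega> Y \<longrightarrow>
        nabla x v (\<lambda>y. J y (Y y)) - J x (nabla x v Y) = 0)"

definition locally_metallic ::
  "('m::topological_space, 'e::euclidean_space) chart set \<Rightarrow> ('m \<Rightarrow> 'e \<Rightarrow> 'e \<Rightarrow> real) \<Rightarrow>
   ('m \<Rightarrow> 'e \<Rightarrow> 'e) \<Rightarrow> nat \<Rightarrow> nat \<Rightarrow> ('m \<Rightarrow> 'e \<Rightarrow> ('m \<Rightarrow> 'e) \<Rightarrow> 'e) \<Rightarrow> bool" where
  "locally_metallic A g J p q nabla \<longleftrightarrow>
     metallic_semi_riemannian A g J p q \<and> levi_civita_connection A g nabla \<and>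
     parallel_endomorphism A nabla J"


section \<open>Submanifolds and bundles along them\<close>

text \<open>
  A submanifold is an injectively immersed manifold \<open>\<iota> : N \<rightarrow> M\<close> (embedded ones included). The
  tangent space of \<open>N\<close> at \<open>x\<close> is regarded as a subspace of that of \<open>M\<close> at \<open>\<iota> x\<close>; accordingly all
  bundles over \<open>N\<close> are subbundles of \<open>\<iota>\<^sup>*TM\<close>, given by their fibres \<open>E x\<close>.
\<close>

definition immersed_submanifold ::
  "('n::topological_space, 'f::euclidean_space) chart set \<Rightarrow>
   ('m::topological_space, 'e::euclidean_space) chart set \<Rightarrow> ('n \<Rightarrow> 'm) \<Rightarrow> bool" where
  "immersed_submanifold B A \<iota> \<longleftrightarrow> smooth_atlas B \<and> smooth_map B A \<iota> \<and> inj \<iota> \<and>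
     (\<forall>x. inj (tangent_map B A \<iota> x))"

definition local_frame ::
  "('n, 'f::euclidean_space) chart set \<Rightarrow> ('m, 'e::euclidean_space) chart set \<Rightarrow> ('n \<Rightarrow> 'm) \<Rightarrow>
   nat \<Rightarrow> ('n \<Rightarrow> 'e set) \<Rightarrow> 'n set \<Rightarrow> (nat \<Rightarrow> 'n \<Rightarrow> 'e) \<Rightarrow> bool" where
  "local_frame B A \<iota> k E \<Omega> e \<longleftrightarrow> (\<forall>i<k. smooth_along B A \<iota> \<Omega> (e i)) \<and>
     (\<forall>x\<in>\<Omega>. inj_on (\<lambda>i. e i x) {..<k} \<and> independent ((\<lambda>i. e i x) ` {..<k}) \<and>
        span ((\<lambda>i. e i x) ` {..<k}) = E x)"

definition smooth_subbundle ::
  "('n::topological_space, 'f::euclidean_space) chart set \<Rightarrow>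
   ('m, 'e::euclidean_space) chart set \<Rightarrow> ('n \<Rightarrow> 'm) \<Rightarrow> nat \<Rightarrow> ('n \<Rightarrow> 'e set) \<Rightarrow> bool" where
  "smooth_subbundle B A \<iota> k E \<longleftrightarrow>
     (\<forall>x. \<exists>\<Omega> e. open \<Omega> \<and> x \<in> \<Omega> \<and> local_frame B A \<iota> k E \<Omega> e)"

definition sections ::
  "('n, 'f::euclidean_space) chart set \<Rightarrow> ('m, 'e::euclidean_space) chart set \<Rightarrow> ('n \<Rightarrow> 'm) \<Rightarrow>
   ('n \<Rightarrow> 'e set) \<Rightarrow> ('n \<Rightarrow> 'e) set" where
  "sections B A \<iota> E = {X. smooth_along B A \<iota> UNIV X \<and> (\<forall>x. X x \<in> E x)}"

definition is_direct_sum :: "'e::real_vector set \<Rightarrow> 'e set \<Rightarrow> 'e set \<Rightarrow> bool" where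
  "is_direct_sum V W T \<longleftrightarrow> {v + w |v w. v \<in> V \<and> w \<in> W} = T \<and> V \<inter> W = {0}"

definition orthogonal_sets :: "('e::real_vector \<Rightarrow> 'e \<Rightarrow> real) \<Rightarrow> 'e set \<Rightarrow> 'e set \<Rightarrow> bool" where
  "orthogonal_sets b V W \<longleftrightarrow> (\<forall>v\<in>V. \<forall>w\<in>W. b v w = 0)"

definition TN ::
  "('n, 'f::euclidean_space) chart set \<Rightarrow> ('m, 'e::euclidean_space) chart set \<Rightarrow> ('n \<Rightarrow> 'm) \<Rightarrow>
   'n \<Rightarrow> 'e set" where
  "TN B A \<iota> x = range (tangent_map B A \<iota> x)"

definition TN_perp ::
  "('n, 'f::euclidean_space) chart set \<Rightarrow> ('m, 'e::euclidean_space) chart set \<Rightarrow>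
   ('m \<Rightarrow> 'e \<Rightarrow> 'e \<Rightarrow> real) \<Rightarrow> ('n \<Rightarrow> 'm) \<Rightarrow> 'n \<Rightarrow> 'e set" where
  "TN_perp B A g \<iota> x = {v. \<forall>u\<in>TN B A \<iota> x. g (\<iota> x) v u = 0}"

definition Rad ::
  "('n, 'f::euclidean_space) chart set \<Rightarrow> ('m, 'e::euclidean_space) chart set \<Rightarrow>
   ('m \<Rightarrow> 'e \<Rightarrow> 'e \<Rightarrow> real) \<Rightarrow> ('n \<Rightarrow> 'm) \<Rightarrow> 'n \<Rightarrow> 'e set" where
  "Rad B A g \<iota> x = TN B A \<iota> x \<inter> TN_perp B A g \<iota> x"


section \<open>Lightlike submanifolds\<close>

definition lightlike_submanifold ::
  "('n::topological_space, 'f::euclidean_space) chart set \<Rightarrow>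
   ('m::topological_space, 'e::euclidean_space) chart set \<Rightarrow>
   ('m \<Rightarrow> 'e \<Rightarrow> 'e \<Rightarrow> real) \<Rightarrow> ('n \<Rightarrow> 'm) \<Rightarrow> nat \<Rightarrow> bool" where
  "lightlike_submanifold B A g \<iota> r \<longleftrightarrow> immersed_submanifold B A \<iota> \<and>
     (\<forall>x. \<not> nondegenerate_on (g (\<iota> x)) (TN B A \<iota> x)) \<and>
     1 \<le> r \<and> r \<le> DIM('f) \<and> smooth_subbundle B A \<iota> r (Rad B A g \<iota>)"

definition screen_distribution ::
  "('n::topological_space, 'f::euclidean_space) chart set \<Rightarrow>
   ('m::topological_space, 'e::euclidean_space) chart set \<Rightarrow>
   ('m \<Rightarrow> 'e \<Rightarrow> 'e \<Rightarrow> real) \<Rightarrow> ('n \<Rightarrow> 'm) \<Rightarrow> ('n \<Rightarrow> 'e set) \<Rightarrow> bool" where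
  "screen_distribution B A g \<iota> S \<longleftrightarrow> (\<exists>k. smooth_subbundle B A \<iota> k S) \<and>
     (\<forall>x. is_direct_sum (Rad B A g \<iota> x) (S x) (TN B A \<iota> x) \<and> nondegenerate_on (g (\<iota> x)) (S x))"

definition screen_transversal_bundle ::
  "('n::topological_space, 'f::euclidean_space) chart set \<Rightarrow>
   ('m::topological_space, 'e::euclidean_space) chart set \<Rightarrow>
   ('m \<Rightarrow> 'e \<Rightarrow> 'e \<Rightarrow> real) \<Rightarrow> ('n \<Rightarrow> 'm) \<Rightarrow> ('n \<Rightarrow> 'e set) \<Rightarrow> bool" where
  "screen_transversal_bundle B A g \<iota> Str \<longleftrightarrow> (\<exists>k. smooth_subbundle B A \<iota> k Str) \<and>
     (\<forall>x. is_direct_sum (Rad B A g \<iota> x) (Str x) (TN_perp B A g \<iota> x) \<and>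
        nondegenerate_on (g (\<iota> x)) (Str x))"

definition lightlike_transversal_bundle ::
  "('n::topological_space, 'f::euclidean_space) chart set \<Rightarrow>
   ('m::topological_space, 'e::euclidean_space) chart set \<Rightarrow>
   ('m \<Rightarrow> 'e \<Rightarrow> 'e \<Rightarrow> real) \<Rightarrow> ('n \<Rightarrow> 'm) \<Rightarrow> nat \<Rightarrow>
   ('n \<Rightarrow> 'e set) \<Rightarrow> ('n \<Rightarrow> 'e set) \<Rightarrow> ('n \<Rightarrow> 'e set) \<Rightarrow> bool" where
  "lightlike_transversal_bundle B A g \<iota> r S Str ltr \<longleftrightarrow>
     (\<forall>x. orthogonal_sets (g (\<iota> x)) (ltr x) (S x) \<and> orthogonal_sets (g (\<iota> x)) (ltr x) (Str x)) \<and>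
     (\<forall>\<Omega> \<xi>. open \<Omega> \<longrightarrow> local_frame B A \<iota> r (Rad B A g \<iota>) \<Omega> \<xi> \<longrightarrow>
        (\<forall>x\<in>\<Omega>. \<exists>\<Omega>' N. open \<Omega>' \<and> x \<in> \<Omega>' \<and> \<Omega>' \<subseteq> \<Omega> \<and> local_frame B A \<iota> r ltr \<Omega>' N \<and>
           (\<forall>y\<in>\<Omega>'. \<forall>i<r. \<forall>j<r.
              g (\<iota> y) (\<xi> i y) (N j y) = (if i = j then 1 else 0) \<and>
              g (\<iota> y) (N i y) (N j y) = 0)))"

text \<open>
  The covariant derivative of vector fields along \<open>\<iota>\<close>: the pull-back connection, determined (on
  fields smooth near the point) by the rules of a covariant derivative and by its agreement with
  \<open>nabla\<close> on fields \<open>Y \<circ> \<iota>\<close> that come from the ambient manifold. The direction \<open>w\<close> is an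
  intrinsic tangent vector of \<open>N\<close> at \<open>x\<close>.
\<close>

definition pullback_connection ::
  "('n::topological_space, 'f::euclidean_space) chart set \<Rightarrow>
   ('m::topological_space, 'e::euclidean_space) chart set \<Rightarrow> ('n \<Rightarrow> 'm) \<Rightarrow>
   ('m \<Rightarrow> 'e \<Rightarrow> ('m \<Rightarrow> 'e) \<Rightarrow> 'e) \<Rightarrow> ('n \<Rightarrow> 'f \<Rightarrow> ('n \<Rightarrow> 'e) \<Rightarrow> 'e) \<Rightarrow> bool" where
  "pullback_connection B A \<iota> nabla D \<longleftrightarrow>
     (\<forall>\<Omega> x U. open \<Omega> \<longrightarrow> x \<in> \<Omega> \<longrightarrow> smooth_along B A \<iota> \<Omega> U \<longrightarrow> linear (\<lambda>w. D x w U)) \<and>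
     (\<forall>\<Omega> x w U V. open \<Omega> \<longrightarrow> x \<in> \<Omega> \<longrightarrow> smooth_along B A \<iota> \<Omega> U \<longrightarrow> smooth_along B A \<iota> \<Omega> V \<longrightarrow>
        D x w (\<lambda>y. U y + V y) = D x w U + D x w V) \<and>
     (\<forall>\<Omega> x w f U. open \<Omega> \<longrightarrow> x \<in> \<Omega> \<longrightarrow> smooth_fun_on B \<Omega> f \<longrightarrow> smooth_along B A \<iota> \<Omega> U \<longrightarrow>
        D x w (\<lambda>y. f y *\<^sub>R U y) = dir_deriv B x w f *\<^sub>R U x + f x *\<^sub>R D x w U) \<and>
     (\<forall>\<Omega> x w Y. open \<Omega> \<longrightarrow> \<iota> x \<in> \<Omega> \<longrightarrow> smooth_vf_on A \<Omega> Y \<longrightarrow>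
        D x w (\<lambda>y. Y (\<iota> y)) = nabla (\<iota> x) (tangent_map B A \<iota> x w) Y)"

text \<open>\<open>amb_deriv B A \<iota> D W U\<close> is \<open>\<nabla>\<^sub>WU\<close> (ambient connection) for \<open>W\<close> tangent to the submanifold.\<close>

definition amb_deriv ::
  "('n, 'f::euclidean_space) chart set \<Rightarrow> ('m, 'e::euclidean_space) chart set \<Rightarrow> ('n \<Rightarrow> 'm) \<Rightarrow>
   ('n \<Rightarrow> 'f \<Rightarrow> ('n \<Rightarrow> 'e) \<Rightarrow> 'e) \<Rightarrow> ('n \<Rightarrow> 'e) \<Rightarrow> ('n \<Rightarrow> 'e) \<Rightarrow> 'n \<Rightarrow> 'e" where
  "amb_deriv B A \<iota> D W U x = D x (inv (tangent_map B A \<iota> x) (W x)) U"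

text \<open>
  The components of a vector with respect to \<open>T\<^sub>xN \<oplus> ltr \<oplus> S(TN\<^sup>\<bottom>)\<close>, the decomposition used in the
  Gauss and Weingarten formulas.
\<close>

definition gw_components :: "'e::real_vector set \<Rightarrow> 'e set \<Rightarrow> 'e set \<Rightarrow> 'e \<Rightarrow> 'e \<times> 'e \<times> 'e" where
  "gw_components T L Z v =
     (THE (a, b, c). a \<in> T \<and> b \<in> L \<and> c \<in> Z \<and> v = a + b + c)"

definition induced_deriv ::
  "('n, 'f::euclidean_space) chart set \<Rightarrow> ('m, 'e::euclidean_space) chart set \<Rightarrow> ('n \<Rightarrow> 'm) \<Rightarrow>
   ('n \<Rightarrow> 'f \<Rightarrow> ('n \<Rightarrow> 'e) \<Rightarrow> 'e) \<Rightarrow> ('n \<Rightarrow> 'e set) \<Rightarrow> ('n \<Rightarrow> 'e set) \<Rightarrow>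
   ('n \<Rightarrow> 'e) \<Rightarrow> ('n \<Rightarrow> 'e) \<Rightarrow> 'n \<Rightarrow> 'e" where
  "induced_deriv B A \<iota> D ltr Str W U x =
     fst (gw_components (TN B A \<iota> x) (ltr x) (Str x) (amb_deriv B A \<iota> D W U x))"

definition h_s ::
  "('n, 'f::euclidean_space) chart set \<Rightarrow> ('m, 'e::euclidean_space) chart set \<Rightarrow> ('n \<Rightarrow> 'm) \<Rightarrow>
   ('n \<Rightarrow> 'f \<Rightarrow> ('n \<Rightarrow> 'e) \<Rightarrow> 'e) \<Rightarrow> ('n \<Rightarrow> 'e set) \<Rightarrow> ('n \<Rightarrow> 'e set) \<Rightarrow>
   ('n \<Rightarrow> 'e) \<Rightarrow> ('n \<Rightarrow> 'e) \<Rightarrow> 'n \<Rightarrow> 'e" where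
  "h_s B A \<iota> D ltr Str W U x =
     snd (snd (gw_components (TN B A \<iota> x) (ltr x) (Str x) (amb_deriv B A \<iota> D W U x)))"

definition nabla_s ::
  "('n, 'f::euclidean_space) chart set \<Rightarrow> ('m, 'e::euclidean_space) chart set \<Rightarrow> ('n \<Rightarrow> 'm) \<Rightarrow>
   ('n \<Rightarrow> 'f \<Rightarrow> ('n \<Rightarrow> 'e) \<Rightarrow> 'e) \<Rightarrow> ('n \<Rightarrow> 'e set) \<Rightarrow> ('n \<Rightarrow> 'e set) \<Rightarrow>
   ('n \<Rightarrow> 'e) \<Rightarrow> ('n \<Rightarrow> 'e) \<Rightarrow> 'n \<Rightarrow> 'e" where
  "nabla_s B A \<iota> D ltr Str W Z x =
     snd (snd (gw_components (TN B A \<iota> x) (ltr x) (Str x) (amb_deriv B A \<iota> D W Z x)))"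


section \<open>Screen transversal anti-invariant lightlike submanifolds\<close>

definition screen_transversal_anti_invariant ::
  "('n, 'f::euclidean_space) chart set \<Rightarrow> ('m, 'e::euclidean_space) chart set \<Rightarrow>
   ('m \<Rightarrow> 'e \<Rightarrow> 'e \<Rightarrow> real) \<Rightarrow> ('m \<Rightarrow> 'e \<Rightarrow> 'e) \<Rightarrow> ('n \<Rightarrow> 'm) \<Rightarrow>
   ('n \<Rightarrow> 'e set) \<Rightarrow> ('n \<Rightarrow> 'e set) \<Rightarrow> bool" where
  "screen_transversal_anti_invariant B A g J \<iota> S Str \<longleftrightarrow>
     (\<forall>x. J (\<iota> x) ` Rad B A g \<iota> x \<subseteq> Str x \<and> J (\<iota> x) ` S x \<subseteq> Str x)"

text \<open>The orthogonal complement \<open>D\<^sub>o\<close> of \<open>J Rad \<oplus> J ltr \<oplus> J S\<close> in the screen transversal bundle.\<close>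

definition D_o ::
  "('n, 'f::euclidean_space) chart set \<Rightarrow> ('m, 'e::euclidean_space) chart set \<Rightarrow>
   ('m \<Rightarrow> 'e \<Rightarrow> 'e \<Rightarrow> real) \<Rightarrow> ('m \<Rightarrow> 'e \<Rightarrow> 'e) \<Rightarrow> ('n \<Rightarrow> 'm) \<Rightarrow>
   ('n \<Rightarrow> 'e set) \<Rightarrow> ('n \<Rightarrow> 'e set) \<Rightarrow> ('n \<Rightarrow> 'e set) \<Rightarrow> 'n \<Rightarrow> 'e set" where
  "D_o B A g J \<iota> S Str ltr x =
     {v \<in> Str x. \<forall>u \<in> Rad B A g \<iota> x \<union> ltr x \<union> S x. g (\<iota> x) v (J (\<iota> x) u) = 0}"

definition screen_transversal_decomposition ::
  "('n, 'f::euclidean_space) chart set \<Rightarrow> ('m, 'e::euclidean_space) chart set \<Rightarrow>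
   ('m \<Rightarrow> 'e \<Rightarrow> 'e \<Rightarrow> real) \<Rightarrow> ('m \<Rightarrow> 'e \<Rightarrow> 'e) \<Rightarrow> ('n \<Rightarrow> 'm) \<Rightarrow>
   ('n \<Rightarrow> 'e set) \<Rightarrow> ('n \<Rightarrow> 'e set) \<Rightarrow> ('n \<Rightarrow> 'e set) \<Rightarrow> bool" where
  "screen_transversal_decomposition B A g J \<iota> S Str ltr \<longleftrightarrow>
     (\<forall>x. J (\<iota> x) ` ltr x \<subseteq> Str x \<and>
        nondegenerate_on (g (\<iota> x)) (D_o B A g J \<iota> S Str ltr x) \<and>
        (\<exists>P Q. is_direct_sum (J (\<iota> x) ` Rad B A g \<iota> x) (J (\<iota> x) ` ltr x) P \<and>
           is_direct_sum P (J (\<iota> x) ` S x) Q \<and>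
           is_direct_sum Q (D_o B A g J \<iota> S Str ltr x) (Str x)))"

text \<open>
  For \<open>W\<close>, \<open>U\<close> sections of \<open>S(TN)\<close> the field \<open>\<nabla>\<^sub>WU\<close> is a smooth section of \<open>TN\<close>, so its belonging to
  \<open>\<Gamma>(S(TN))\<close> means that its values lie in \<open>S(TN)\<close>.
\<close>

definition screen_totally_geodesic_foliation ::
  "('n, 'f::euclidean_space) chart set \<Rightarrow> ('m, 'e::euclidean_space) chart set \<Rightarrow> ('n \<Rightarrow> 'm) \<Rightarrow>
   ('n \<Rightarrow> 'f \<Rightarrow> ('n \<Rightarrow> 'e) \<Rightarrow> 'e) \<Rightarrow>
   ('n \<Rightarrow> 'e set) \<Rightarrow> ('n \<Rightarrow> 'e set) \<Rightarrow> ('n \<Rightarrow> 'e set) \<Rightarrow> bool" where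
  "screen_totally_geodesic_foliation B A \<iota> D S Str ltr \<longleftrightarrow>
     (\<forall>W \<in> sections B A \<iota> S. \<forall>U \<in> sections B A \<iota> S.
        \<forall>x. induced_deriv B A \<iota> D ltr Str W U x \<in> S x)"

definition no_component_in_J_ltr ::
  "('n, 'f::euclidean_space) chart set \<Rightarrow> ('m, 'e::euclidean_space) chart set \<Rightarrow>
   ('m \<Rightarrow> 'e \<Rightarrow> 'e \<Rightarrow> real) \<Rightarrow> ('m \<Rightarrow> 'e \<Rightarrow> 'e) \<Rightarrow> ('n \<Rightarrow> 'm) \<Rightarrow>
   ('n \<Rightarrow> 'e set) \<Rightarrow> ('n \<Rightarrow> 'e) \<Rightarrow> bool" where
  "no_component_in_J_ltr B A g J \<iota> ltr X \<longleftrightarrow>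
     (\<forall>N \<in> sections B A \<iota> ltr. \<forall>x. g (\<iota> x) (X x) (J (\<iota> x) (N x)) = 0)"

end

theory Submission
  imports Defs
begin

text \<open>
  Let \<open>W\<close>, \<open>U\<close> be sections of the screen distribution, let \<open>v\<close> be the ambient derivative of \<open>U\<close> in
  direction \<open>W\<close>, and let \<open>N\<close> be a section of \<open>ltr\<close>. Since \<open>J\<close> is parallel, the ambient derivative of
  \<open>JU\<close> is \<open>Jv\<close>. As \<open>J\<close> is self-adjoint with \<open>J\<^sup>2 = p J + q\<close>,
  \<open>g(Jv, JN) = g(v, J\<^sup>2N) = p g(v, JN) + q g(v, N)\<close>. The vector \<open>JN\<close> lies in the screen transversal
  bundle, which is orthogonal to the tangent bundle and to \<open>ltr\<close>; so on the left only \<open>\<nabla>\<^sup>s\<^sub>W JU\<close>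
  survives and in the first term on the right only \<open>h\<^sup>s(W, U)\<close>. As \<open>ltr\<close> is isotropic and orthogonal to
  the screen transversal bundle, in the last term only the induced derivative survives. Hence
  \<open>g(\<nabla>\<^sup>s\<^sub>W JU - p h\<^sup>s(W, U), JN) = q g(\<nabla>\<^sub>WU, N)\<close> (lemma \<open>nabla_s_J_component\<close>). Since \<open>q > 0\<close>, the left
  side vanishes for all \<open>N\<close> if and only if \<open>\<nabla>\<^sub>WU\<close> is orthogonal to \<open>ltr\<close>, and for a tangent vector
  this means lying in the screen distribution, because \<open>ltr\<close> is dual to the radical
  (\<open>mem_screen_iff_orthogonal_ltr\<close>).

  Three points of this argument need preparation. The identity for the derivative of \<open>JU\<close>
  concerns fields defined only along the submanifold, while \<open>J\<close> is parallel with respect to the ambient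
  connection; fields along the submanifold are therefore expanded in an ambient coordinate frame
  (\<open>pullback_connection_parallel\<close>). The orthogonality to all global sections of \<open>ltr\<close> gives orthogonality
  to each vector of a fibre only if there are enough global sections; they are built with bump
  functions (\<open>section_through\<close>). Finally, the components in the Gauss and Weingarten formulas are given
  by definite descriptions, and existence and uniqueness of the decomposition follow by counting
  dimensions (\<open>gauss_weingarten_decomposition\<close>).
\<close>

section \<open>Calculus of smooth functions on open sets\<close>

lemma Ck_on_cong:
  assumes "open S" "\<And>x. x \<in> S \<Longrightarrow> f x = h x" "Ck_on k S f"
  shows "Ck_on k S h"
  using assms(2,3)
proof (induction k arbitrary: f h)
  case 0
  then show ?case by (simp cong: continuous_on_cong)
next
  case (Suc k)
  have deriv: "(h has_derivative frechet_derivative f (at x)) (at x)" if "x \<in> S" for x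
    using Suc.prems that assms(1)
    by (auto intro: has_derivative_transform_within_open simp: frechet_derivative_works)
  have "Ck_on k S (\<lambda>x. frechet_derivative h (at x) v)" for v
    by (rule Suc.IH[of "\<lambda>x. frechet_derivative f (at x) v"])
      (use Suc.prems in \<open>auto simp: frechet_derivative_at[OF deriv]\<close>)
  then show ?case
    using deriv by (auto intro: differentiableI)
qed

lemma Ck_on_SucI:
  assumes "open S" and deriv: "\<And>x. x \<in> S \<Longrightarrow> (f has_derivative f' x) (at x)"
    and "\<And>v. Ck_on k S (\<lambda>x. f' x v)"
  shows "Ck_on (Suc k) S f"
  unfolding Ck_on.simps
proof (intro conjI ballI allI)
  show "f differentiable at x" if "x \<in> S" for x
    using deriv[OF that] by (rule differentiableI)
  show "Ck_on k S (\<lambda>x. frechet_derivative f (at x) v)" for v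
    by (rule Ck_on_cong[OF assms(1) _ assms(3)[of v]]) (simp add: frechet_derivative_at[OF deriv])
qed

lemma Ck_on_has_derivative:
  assumes "Ck_on (Suc k) S f" "x \<in> S"
  shows "(f has_derivative frechet_derivative f (at x)) (at x)"
  using assms by (simp add: frechet_derivative_works)

lemma Ck_on_SucD: "Ck_on (Suc k) S f \<Longrightarrow> Ck_on k S f"
proof (induction k arbitrary: f)
  case 0
  then show ?case
    by (auto intro!: differentiable_imp_continuous_on differentiable_at_imp_differentiable_on)
next
  case (Suc k)
  then show ?case unfolding Ck_on.simps(2)[of _ S f] by blast
qed

lemma Ck_on_subset: "Ck_on k S f \<Longrightarrow> T \<subseteq> S \<Longrightarrow> Ck_on k T f"
  by (induction k arbitrary: f) (auto intro: continuous_on_subset)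

lemma Ck_on_Un: "open S \<Longrightarrow> open T \<Longrightarrow> Ck_on k S f \<Longrightarrow> Ck_on k T f \<Longrightarrow> Ck_on k (S \<union> T) f"
  by (induction k arbitrary: f) (auto intro: continuous_on_open_Un)

lemma Ck_on_const: "Ck_on k S (\<lambda>_. a)"
  by (induction k arbitrary: a) auto

lemma Ck_on_linear:
  assumes "bounded_linear L"
  shows "Ck_on k S L"
proof (cases k)
  case 0
  then show ?thesis using assms by (simp add: linear_continuous_on)
next
  case (Suc n)
  have deriv: "(L has_derivative L) (at x)" for x
    using assms by (rule bounded_linear_imp_has_derivative)
  then show ?thesis
    using Suc
    by (auto simp: Ck_on_const frechet_derivative_at[OF deriv, symmetric] intro: differentiableI)
qed

lemma Ck_on_add:
  assumes "open S" "Ck_on k S f" "Ck_on k S h"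
  shows "Ck_on k S (\<lambda>x. f x + h x)"
  using assms(2,3)
proof (induction k arbitrary: f h)
  case 0
  then show ?case by (auto intro: continuous_intros)
next
  case (Suc k)
  show ?case
  proof (rule Ck_on_SucI)
    show "((\<lambda>x. f x + h x) has_derivative
        (\<lambda>v. frechet_derivative f (at x) v + frechet_derivative h (at x) v)) (at x)"
      if "x \<in> S" for x
      by (rule has_derivative_add[OF Suc.prems[THEN Ck_on_has_derivative, OF that]])
  qed (use Suc assms(1) in auto)
qed

lemma Ck_on_bounded_linear:
  assumes "bounded_linear L" "open S" "Ck_on k S f"
  shows "Ck_on k S (\<lambda>x. L (f x))"
  using assms(3)
proof (induction k arbitrary: f)
  case 0
  then show ?case
    using bounded_linear.continuous_on[OF assms(1), of S f] by simp
next
  case (Suc k)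
  show ?case
  proof (rule Ck_on_SucI)
    show "((\<lambda>x. L (f x)) has_derivative (\<lambda>v. L (frechet_derivative f (at x) v))) (at x)"
      if "x \<in> S" for x
      by (rule bounded_linear.has_derivative[OF assms(1) Ck_on_has_derivative[OF Suc.prems that]])
  qed (use Suc assms(2) in auto)
qed

lemma Ck_on_sum:
  assumes "open S" "finite I" "\<And>i. i \<in> I \<Longrightarrow> Ck_on k S (f i)"
  shows "Ck_on k S (\<lambda>x. \<Sum>i\<in>I. f i x)"
  using assms(2,3) by (induction I) (auto simp: Ck_on_const Ck_on_add assms(1))

lemma Ck_on_scaleR:
  fixes f :: "'a::euclidean_space \<Rightarrow> real" and h :: "'a \<Rightarrow> 'b::euclidean_space"
  assumes "open S" "Ck_on k S f" "Ck_on k S h"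
  shows "Ck_on k S (\<lambda>x. f x *\<^sub>R h x)"
  using assms(2,3)
proof (induction k arbitrary: f h)
  case 0
  then show ?case by (auto intro: continuous_intros)
next
  case (Suc k)
  have *: "Ck_on k S f" "Ck_on k S h"
    using Suc.prems Ck_on_SucD by auto
  let ?f' = "\<lambda>x. frechet_derivative f (at x)" and ?h' = "\<lambda>x. frechet_derivative h (at x)"
  show ?case
  proof (rule Ck_on_SucI)
    show "((\<lambda>x. f x *\<^sub>R h x) has_derivative (\<lambda>v. f x *\<^sub>R ?h' x v + ?f' x v *\<^sub>R h x)) (at x)"
      if "x \<in> S" for x
      by (rule has_derivative_scaleR[OF Suc.prems[THEN Ck_on_has_derivative, OF that]])
    show "Ck_on k S (\<lambda>x. f x *\<^sub>R ?h' x v + ?f' x v *\<^sub>R h x)" for v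
      using * Suc.prems assms(1) by (intro Ck_on_add Suc.IH) auto
  qed (use assms(1) in auto)
qed

text \<open>
  The chain rule writes the derivative of \<open>h \<circ> f\<close> in direction \<open>v\<close> as a sum, over the basis, of
  products of \<open>C\<^sup>k\<close> functions, so the induction only needs fixed directions for \<open>h\<close>.
\<close>

lemma Ck_on_compose:
  fixes f :: "'a::euclidean_space \<Rightarrow> 'b::euclidean_space" and h :: "'b \<Rightarrow> 'c::euclidean_space"
  assumes "open S" "f ` S \<subseteq> T" "Ck_on k S f" "Ck_on k T h"
  shows "Ck_on k S (\<lambda>x. h (f x))"
  using assms(3,4)
proof (induction k arbitrary: h)
  case 0
  then show ?case using continuous_on_compose2[of T h S f] assms(2) by simp
next
  case (Suc k)
  let ?f' = "\<lambda>x. frechet_derivative f (at x)" and ?h' = "\<lambda>y. frechet_derivative h (at y)"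
  show ?case
  proof (rule Ck_on_SucI)
    show "((\<lambda>x. h (f x)) has_derivative (\<lambda>v. \<Sum>b\<in>Basis. (?f' x v \<bullet> b) *\<^sub>R ?h' (f x) b)) (at x)"
      if "x \<in> S" for x
    proof -
      have h': "(h has_derivative ?h' (f x)) (at (f x))"
        using Ck_on_has_derivative[OF Suc.prems(2)] assms(2) that by auto
      have "((\<lambda>x. h (f x)) has_derivative (\<lambda>v. ?h' (f x) (?f' x v))) (at x)"
        using Ck_on_has_derivative[OF Suc.prems(1) that] h' by (rule has_derivative_compose)
      moreover have "(\<lambda>v. ?h' (f x) (?f' x v)) = (\<lambda>v. \<Sum>b\<in>Basis. (?f' x v \<bullet> b) *\<^sub>R ?h' (f x) b)"
      proof
        fix v
        let ?u = "?f' x v"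
        have lin: "linear (?h' (f x))"
          using h' by (rule has_derivative_linear)
        have "?h' (f x) ?u = ?h' (f x) (\<Sum>b\<in>Basis. (?u \<bullet> b) *\<^sub>R b)"
          by (simp only: euclidean_representation)
        also have "\<dots> = (\<Sum>b\<in>Basis. (?u \<bullet> b) *\<^sub>R ?h' (f x) b)"
          by (simp only: linear_sum[OF lin] linear_scale[OF lin])
        finally show "?h' (f x) ?u = (\<Sum>b\<in>Basis. (?u \<bullet> b) *\<^sub>R ?h' (f x) b)" .
      qed
      ultimately show ?thesis by (simp only:)
    qed
    show "Ck_on k S (\<lambda>x. \<Sum>b\<in>Basis. (?f' x v \<bullet> b) *\<^sub>R ?h' (f x) b)" for v
    proof (intro Ck_on_sum Ck_on_scaleR assms(1) finite_Basis)
      fix b :: 'b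
      have *: "Ck_on k S (\<lambda>x. ?f' x v)" "Ck_on k T (\<lambda>y. ?h' y b)" "Ck_on k S f"
        using Suc.prems Ck_on_SucD by auto
      show "Ck_on k S (\<lambda>x. ?h' (f x) b)"
        using *(3,2) by (rule Suc.IH)
      show "Ck_on k S (\<lambda>x. ?f' x v \<bullet> b)"
        using bounded_linear_inner_left assms(1) *(1) by (rule Ck_on_bounded_linear)
    qed
  qed (use assms(1) in auto)
qed

lemma smooth_on_cong: "open S \<Longrightarrow> (\<And>x. x \<in> S \<Longrightarrow> f x = h x) \<Longrightarrow> smooth_on S f \<Longrightarrow> smooth_on S h"
  unfolding smooth_on_def by (auto intro: Ck_on_cong)

lemma smooth_on_subset: "smooth_on S f \<Longrightarrow> T \<subseteq> S \<Longrightarrow> smooth_on T f"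
  unfolding smooth_on_def by (auto intro: Ck_on_subset)

lemma smooth_on_Un:
  "open S \<Longrightarrow> open T \<Longrightarrow> smooth_on S f \<Longrightarrow> smooth_on T f \<Longrightarrow> smooth_on (S \<union> T) f"
  unfolding smooth_on_def by (intro allI, rule Ck_on_Un) auto

lemma smooth_on_const: "smooth_on S (\<lambda>_. a)"
  unfolding smooth_on_def by (auto intro!: Ck_on_const)

lemma smooth_on_id: "smooth_on S (\<lambda>x. x)"
  unfolding smooth_on_def by (auto intro!: Ck_on_linear[OF bounded_linear_ident])

lemma smooth_on_add:
  "open S \<Longrightarrow> smooth_on S f \<Longrightarrow> smooth_on S h \<Longrightarrow> smooth_on S (\<lambda>x. f x + h x)"
  unfolding smooth_on_def by (intro allI, rule Ck_on_add) auto

lemma smooth_on_bounded_linear: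
  "bounded_linear L \<Longrightarrow> open S \<Longrightarrow> smooth_on S f \<Longrightarrow> smooth_on S (\<lambda>x. L (f x))"
  unfolding smooth_on_def by (intro allI, rule Ck_on_bounded_linear) auto

lemma smooth_on_sum:
  "open S \<Longrightarrow> finite I \<Longrightarrow> (\<And>i. i \<in> I \<Longrightarrow> smooth_on S (f i)) \<Longrightarrow>
    smooth_on S (\<lambda>x. \<Sum>i\<in>I. f i x)"
  unfolding smooth_on_def by (auto intro!: Ck_on_sum[of S I _ f])

lemma smooth_on_scaleR:
  fixes f :: "'a::euclidean_space \<Rightarrow> real"
  shows "open S \<Longrightarrow> smooth_on S f \<Longrightarrow> smooth_on S h \<Longrightarrow> smooth_on S (\<lambda>x. f x *\<^sub>R h x)"
  unfolding smooth_on_def by (intro allI, rule Ck_on_scaleR) simp_all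

lemma smooth_on_compose:
  "open S \<Longrightarrow> f ` S \<subseteq> T \<Longrightarrow> smooth_on S f \<Longrightarrow> smooth_on T h \<Longrightarrow> smooth_on S (\<lambda>x. h (f x))"
  unfolding smooth_on_def by (intro allI, rule Ck_on_compose[where T = T]) simp_all

lemma smooth_on_has_derivative:
  "smooth_on S f \<Longrightarrow> x \<in> S \<Longrightarrow> (f has_derivative frechet_derivative f (at x)) (at x)"
  unfolding smooth_on_def using Ck_on_has_derivative by blast

lemma smooth_on_frechet_derivative:
  "smooth_on S f \<Longrightarrow> smooth_on S (\<lambda>x. frechet_derivative f (at x) v)"
  unfolding smooth_on_def
proof
  fix k
  assume "\<forall>k. Ck_on k S f"
  then have "Ck_on (Suc k) S f" ..
  then show "Ck_on k S (\<lambda>x. frechet_derivative f (at x) v)"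
    unfolding Ck_on.simps by blast
qed

section \<open>Smooth bump functions\<close>

text \<open>
  The functions \<open>t\<^sup>-\<^sup>n exp (-1/t)\<close>, extended by \<open>0\<close> to \<open>t \<le> 0\<close>. The derivative of one of them is a
  linear combination of two others, so all of them are smooth; for \<open>n = 0\<close> this is the standard
  function that is positive exactly on the positive reals.
\<close>

definition flat_fun :: "nat \<Rightarrow> real \<Rightarrow> real" where
  "flat_fun n t = (if t > 0 then inverse t ^ n * exp (- inverse t) else 0)"

lemma flat_fun_has_derivative:
  "(flat_fun n has_real_derivative flat_fun (n + 2) t - real n * flat_fun (n + 1) t) (at t)"
proof (cases t "0::real" rule: linorder_cases)
  case less
  have "((\<lambda>_. 0) has_real_derivative 0) (at t)"
    by simp
  then have "(flat_fun n has_real_derivative 0) (at t)"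
    by (rule has_field_derivative_transform_within_open[of _ _ _ "{..<0}"])
      (use less in \<open>auto simp: flat_fun_def\<close>)
  then show ?thesis using less by (simp add: flat_fun_def)
next
  case greater
  define u where "u = inverse t"
  have "((\<lambda>u. u ^ n * exp (- u)) has_real_derivative
      (real n * u ^ (n - 1) - u ^ n) * exp (- u)) (at u)"
    by (auto intro!: derivative_eq_intros simp: algebra_simps)
  moreover have "(inverse has_real_derivative (- (u\<^sup>2))) (at t)"
    using DERIV_inverse[of t] greater by (simp add: u_def power2_eq_square)
  ultimately have "((\<lambda>t. inverse t ^ n * exp (- inverse t)) has_real_derivative
      ((real n * u ^ (n - 1) - u ^ n) * exp (- u) * (- (u\<^sup>2)))) (at t)"
    unfolding u_def by (rule DERIV_chain2)
  moreover have "(real n * u ^ (n - 1) - u ^ n) * exp (- u) * (- (u\<^sup>2)) =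
      flat_fun (n + 2) t - real n * flat_fun (n + 1) t"
    using greater
    by (cases n) (simp_all add: algebra_simps power2_eq_square flat_fun_def flip: u_def)
  ultimately have "((\<lambda>t. inverse t ^ n * exp (- inverse t)) has_real_derivative
      flat_fun (n + 2) t - real n * flat_fun (n + 1) t) (at t)"
    by simp
  then show ?thesis
    by (rule has_field_derivative_transform_within_open[of _ _ _ "{0<..}"])
      (use greater in \<open>auto simp: flat_fun_def\<close>)
next
  case equal
  \<comment> \<open>for \<open>t > 0\<close> the difference quotient at \<open>0\<close> is \<open>t\<^sup>-\<^sup>n\<^sup>-\<^sup>1 exp (-1/t)\<close>, for \<open>t < 0\<close> it is \<open>0\<close>\<close>
  have "((\<lambda>t. inverse t ^ (n + 1) * exp (- inverse t)) \<longlongrightarrow> 0) (at_right (0::real))"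
    using filterlim_compose[OF tendsto_power_div_exp_0 filterlim_inverse_at_top_right, of "n + 1"]
    by (simp add: exp_minus divide_inverse)
  then have "((\<lambda>t. flat_fun n t / t) \<longlongrightarrow> 0) (at_right 0)"
    by (rule Lim_transform_eventually)
      (auto simp: eventually_at_filter flat_fun_def divide_inverse intro!: always_eventually)
  moreover have "((\<lambda>t. flat_fun n t / t) \<longlongrightarrow> 0) (at_left 0)"
    by (rule tendsto_eventually) (auto simp: eventually_at_filter flat_fun_def)
  ultimately have "((\<lambda>t. flat_fun n t / t) \<longlongrightarrow> 0) (at 0)"
    by (simp add: filterlim_split_at)
  then show ?thesis
    using equal by (simp add: has_field_derivative_iff flat_fun_def)
qed

lemma smooth_on_flat_fun: "smooth_on UNIV (flat_fun n)"
proof -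
  have "Ck_on k UNIV (flat_fun n)" for k
  proof (induction k arbitrary: n)
    case 0
    show ?case
      using DERIV_isCont[OF flat_fun_has_derivative] by (simp add: continuous_at_imp_continuous_on)
  next
    case (Suc k)
    let ?F = "\<lambda>x. flat_fun (n + 2) x + (- real n) *\<^sub>R flat_fun (n + 1) x"
    show ?case
    proof (rule Ck_on_SucI)
      show "(flat_fun n has_derivative (\<lambda>v. v *\<^sub>R ?F x)) (at x)" for x
      proof -
        have "(*) (flat_fun (n + 2) x - real n * flat_fun (n + 1) x) = (\<lambda>v. v *\<^sub>R ?F x)"
          by (rule ext) (simp add: mult.commute)
        then show ?thesis
          using flat_fun_has_derivative[of n x] by (simp only: has_field_derivative_def)
      qed
      have "Ck_on k UNIV ?F"
        by (rule Ck_on_add[OF open_UNIV Suc.IH Ck_on_scaleR[OF open_UNIV Ck_on_const Suc.IH]])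
      then show "Ck_on k UNIV (\<lambda>x. v *\<^sub>R ?F x)" for v
        by (rule Ck_on_scaleR[OF open_UNIV Ck_on_const])
    qed (rule open_UNIV)
  qed
  then show ?thesis
    by (simp add: smooth_on_def)
qed

lemma exists_bump_function:
  fixes z :: "'a::euclidean_space"
  assumes "\<epsilon> > 0"
  shows "\<exists>\<beta>::'a \<Rightarrow> real. smooth_on UNIV \<beta> \<and> \<beta> z = 1 \<and> (\<forall>y. y \<notin> ball z \<epsilon> \<longrightarrow> \<beta> y = 0)"
proof -
  \<comment> \<open>\<open>\<rho> y = \<epsilon>\<^sup>2 - |y - z|\<^sup>2\<close> in coordinates; it is positive exactly on the ball\<close>
  define \<rho> :: "'a \<Rightarrow> real" where
    "\<rho> y = \<epsilon>\<^sup>2 + - (\<Sum>b\<in>Basis. ((y + - z) \<bullet> b) *\<^sub>R ((y + - z) \<bullet> b))" for y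
  have \<rho>: "\<rho> y = \<epsilon>\<^sup>2 - (dist z y)\<^sup>2" for y
    using euclidean_inner[of "y - z" "y - z"]
    by (simp add: \<rho>_def dist_norm norm_minus_commute power2_norm_eq_inner)
  have "smooth_on UNIV \<rho>"
    unfolding \<rho>_def
    by (intro smooth_on_add smooth_on_const smooth_on_bounded_linear[of uminus] smooth_on_sum
        smooth_on_scaleR smooth_on_bounded_linear[OF bounded_linear_inner_left] smooth_on_id
        open_UNIV finite_Basis bounded_linear_minus bounded_linear_ident)
  then have "smooth_on UNIV (\<lambda>y. flat_fun 0 (\<rho> y))"
    by (intro smooth_on_compose[OF open_UNIV subset_UNIV _ smooth_on_flat_fun])
  then have "smooth_on UNIV (\<lambda>y. inverse (flat_fun 0 (\<rho> z)) *\<^sub>R flat_fun 0 (\<rho> y))"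
    by (intro smooth_on_scaleR smooth_on_const) auto
  moreover have "flat_fun 0 (\<rho> z) \<noteq> 0"
    using assms by (simp add: flat_fun_def \<rho>)
  moreover have "flat_fun 0 (\<rho> y) = 0" if "y \<notin> ball z \<epsilon>" for y
    using that assms by (auto simp: flat_fun_def \<rho> not_less power_mono)
  ultimately show ?thesis
    by (intro exI[of _ "\<lambda>y. inverse (flat_fun 0 (\<rho> z)) *\<^sub>R flat_fun 0 (\<rho> y)"]) auto
qed


section \<open>Charts and coordinate frames\<close>

lemma atlas_chart_at:
  assumes "smooth_atlas A"
  shows "chart_at A x \<in> A" "x \<in> fst (chart_at A x)"
proof -
  have "\<exists>c. c \<in> A \<and> x \<in> fst c"
    using assms unfolding smooth_atlas_def by blast
  then have "chart_at A x \<in> A \<and> x \<in> fst (chart_at A x)"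
    unfolding chart_at_def by (rule someI_ex)
  then show "chart_at A x \<in> A" "x \<in> fst (chart_at A x)"
    by blast+
qed

lemma
  assumes "smooth_atlas A" "c \<in> A"
  shows open_chart_domain: "open (fst c)"
    and cinv_chart: "y \<in> fst c \<Longrightarrow> cinv c (snd c y) = y"
    and continuous_on_cinv: "continuous_on (snd c ` fst c) (cinv c)"
    and open_chart_image: "open U \<Longrightarrow> open (snd c ` (fst c \<inter> U))"
proof -
  have c: "open (fst c)" "open (snd c ` fst c)"
    "homeomorphism (fst c) (snd c ` fst c) (snd c) (cinv c)"
    using assms by (auto simp: smooth_atlas_def is_chart_def)
  show "open (fst c)" "y \<in> fst c \<Longrightarrow> cinv c (snd c y) = y"
    "continuous_on (snd c ` fst c) (cinv c)"
    using c by (auto simp: homeomorphism_def)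
  show "open (snd c ` (fst c \<inter> U))" if "open U"
    using homeomorphism_imp_open_map[OF c(3), of "fst c \<inter> U"] that c(2)
    by (simp add: openin_open_eq openin_open_Int)
qed

text \<open>
  The derivative at the point \<open>x\<close> of the change of coordinates from the chart \<open>c\<close> to the chart \<open>d\<close>.
  The transformation law \<open>tcoord\<close> is the case where \<open>c\<close> is the chart singled out at \<open>x\<close>.
\<close>

definition transition_deriv ::
  "('m, 'e::euclidean_space) chart \<Rightarrow> ('m, 'e) chart \<Rightarrow> 'm \<Rightarrow> 'e \<Rightarrow> 'e" where
  "transition_deriv c d x v = frechet_derivative (snd d \<circ> cinv c) (at (snd c x)) v"

lemma tcoord_eq_transition_deriv: "tcoord A c x = transition_deriv (chart_at A x) c x"
  by (simp add: fun_eq_iff tcoord_def transition_deriv_def)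

lemma transition_has_derivative:
  assumes "smooth_atlas A" "c \<in> A" "d \<in> A" "x \<in> fst c" "x \<in> fst d"
  shows "((snd d \<circ> cinv c) has_derivative transition_deriv c d x) (at (snd c x))"
proof -
  have "smooth_on (snd c ` (fst c \<inter> fst d)) (snd d \<circ> cinv c)"
    using assms unfolding smooth_atlas_def by blast
  moreover have "snd c x \<in> snd c ` (fst c \<inter> fst d)"
    using assms by blast
  moreover have "transition_deriv c d x = frechet_derivative (snd d \<circ> cinv c) (at (snd c x))"
    by (simp add: fun_eq_iff transition_deriv_def)
  ultimately show ?thesis
    using smooth_on_has_derivative by metis
qed

lemma transition_deriv_cocycle:
  assumes A: "smooth_atlas A" "c \<in> A" "d \<in> A" "e \<in> A" and x: "x \<in> fst c" "x \<in> fst d" "x \<in> fst e"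
  shows "transition_deriv d e x (transition_deriv c d x v) = transition_deriv c e x v"
proof -
  have "((snd d \<circ> cinv c) has_derivative transition_deriv c d x) (at (snd c x))"
    using A x by (intro transition_has_derivative)
  moreover have "((snd e \<circ> cinv d) has_derivative transition_deriv d e x)
      (at ((snd d \<circ> cinv c) (snd c x)))"
    using transition_has_derivative[of A d e x] A x by (simp add: cinv_chart[OF A(1,2)])
  ultimately have "((\<lambda>y. (snd e \<circ> cinv d) ((snd d \<circ> cinv c) y)) has_derivative
      (\<lambda>v. transition_deriv d e x (transition_deriv c d x v))) (at (snd c x))"
    by (rule has_derivative_compose)
  moreover have "open (snd c ` (fst c \<inter> fst d))"
    using A by (intro open_chart_image open_chart_domain)
  moreover have "snd c x \<in> snd c ` (fst c \<inter> fst d)"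
    using x by blast
  ultimately have "((snd e \<circ> cinv c) has_derivative
      (\<lambda>v. transition_deriv d e x (transition_deriv c d x v))) (at (snd c x))"
    by (rule has_derivative_transform_within_open) (use A in \<open>auto simp: cinv_chart\<close>)
  then show ?thesis
    using transition_has_derivative[of A c e x] A x has_derivative_unique by metis
qed

lemma transition_deriv_refl:
  assumes "smooth_atlas A" "c \<in> A" "x \<in> fst c"
  shows "transition_deriv c c x v = v"
proof -
  have "((\<lambda>y. y) has_derivative transition_deriv c c x) (at (snd c x))"
  proof (rule has_derivative_transform_within_open)
    show "((snd c \<circ> cinv c) has_derivative transition_deriv c c x) (at (snd c x))"
      using assms by (intro transition_has_derivative) auto
    show "open (snd c ` (fst c \<inter> fst c))"
      using assms by (intro open_chart_image open_chart_domain)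
  qed (use assms in \<open>auto simp: cinv_chart\<close>)
  then show ?thesis
    using has_derivative_unique[OF _ has_derivative_ident] by metis
qed

lemma linear_tcoord:
  assumes "smooth_atlas A" "d \<in> A" "x \<in> fst d"
  shows "linear (tcoord A d x)"
  using has_derivative_linear[OF transition_has_derivative[of A "chart_at A x" d x]] assms
  by (simp add: tcoord_eq_transition_deriv atlas_chart_at)

text \<open>
  The coordinate vector field on the domain of \<open>d\<close> whose components in \<open>d\<close> are constantly \<open>b\<close>. Its
  value at \<open>m\<close> is expressed, like all tangent vectors, in the chart singled out at \<open>m\<close>.
\<close>

definition coord_field ::
  "('m, 'e::euclidean_space) chart set \<Rightarrow> ('m, 'e) chart \<Rightarrow> 'e \<Rightarrow> 'm \<Rightarrow> 'e" where
  "coord_field A d b m = transition_deriv d (chart_at A m) m b"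

lemma coord_field_expansion:
  assumes "smooth_atlas A" "d \<in> A" "m \<in> fst d"
  shows "(\<Sum>b\<in>Basis. (tcoord A d m v \<bullet> b) *\<^sub>R coord_field A d b m) = v"
proof -
  have lin: "linear (transition_deriv d (chart_at A m) m)"
    using has_derivative_linear[OF transition_has_derivative] assms atlas_chart_at by metis
  have "(\<Sum>b\<in>Basis. (tcoord A d m v \<bullet> b) *\<^sub>R coord_field A d b m) =
      transition_deriv d (chart_at A m) m (\<Sum>b\<in>Basis. (tcoord A d m v \<bullet> b) *\<^sub>R b)"
    by (simp only: coord_field_def linear_sum[OF lin] linear_scale[OF lin])
  also have "\<dots> = transition_deriv d (chart_at A m) m (tcoord A d m v)"
    by (simp only: euclidean_representation)
  also have "\<dots> = v"
    unfolding tcoord_eq_transition_deriv using assms atlas_chart_at[OF assms(1), of m]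
    by (simp add: transition_deriv_cocycle transition_deriv_refl)
  finally show ?thesis .
qed

lemma smooth_coord_field:
  assumes A: "smooth_atlas A" and d: "d \<in> A"
  shows "smooth_vf_on A (fst d) (coord_field A d b)"
  unfolding smooth_vf_on_def smooth_along_def
proof (intro ballI)
  fix c e assume c: "c \<in> A" and e: "e \<in> A"
  let ?S = "snd c ` (fst c \<inter> fst d \<inter> (\<lambda>x. x) -` fst e)"
  have "open (snd c ` (fst c \<inter> (fst d \<inter> fst e)))"
    using A c d e by (intro open_chart_image open_Int open_chart_domain)
  then have "open ?S"
    by (simp add: Int_assoc)
  moreover have "frechet_derivative (snd e \<circ> cinv d) (at ((snd d \<circ> cinv c) y)) b =
      tcoord A e (cinv c y) (coord_field A d b (cinv c y))" if "y \<in> ?S" for y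
  proof -
    from that obtain m where m: "y = snd c m" "m \<in> fst c" "m \<in> fst d" "m \<in> fst e"
      by auto
    then have "tcoord A e m (coord_field A d b m) = transition_deriv d e m b"
      using A d e atlas_chart_at[OF A, of m]
      by (simp add: coord_field_def tcoord_eq_transition_deriv transition_deriv_cocycle)
    then show ?thesis
      using m A c by (simp add: cinv_chart transition_deriv_def)
  qed
  moreover have "smooth_on ?S (\<lambda>y. frechet_derivative (snd e \<circ> cinv d) (at ((snd d \<circ> cinv c) y)) b)"
  proof (rule smooth_on_compose[where f = "snd d \<circ> cinv c" and T = "snd d ` (fst d \<inter> fst e)"])
    have "smooth_on (snd c ` (fst c \<inter> fst d)) (snd d \<circ> cinv c)"
      "smooth_on (snd d ` (fst d \<inter> fst e)) (snd e \<circ> cinv d)"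
      using A c d e unfolding smooth_atlas_def by blast+
    then show "smooth_on ?S (snd d \<circ> cinv c)"
      "smooth_on (snd d ` (fst d \<inter> fst e)) (\<lambda>z. frechet_derivative (snd e \<circ> cinv d) (at z) b)"
      by (auto elim: smooth_on_subset intro!: smooth_on_frechet_derivative)
    show "(snd d \<circ> cinv c) ` ?S \<subseteq> snd d ` (fst d \<inter> fst e)"
      using A c by (auto simp: cinv_chart)
  qed fact
  ultimately show "smooth_on ?S (\<lambda>y. tcoord A e (cinv c y) (coord_field A d b (cinv c y)))"
    by (rule smooth_on_cong)
qed

section \<open>Fields along a smooth map\<close>

text \<open>A smooth map between two manifolds, each given by an atlas.\<close>

locale manifold_map =
  fixes B :: "('n::topological_space, 'f::euclidean_space) chart set"
    and A :: "('m::topological_space, 'e::euclidean_space) chart set"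
    and \<iota> :: "'n \<Rightarrow> 'm"
  assumes atlas_B: "smooth_atlas B" and atlas_A: "smooth_atlas A" and smooth_map: "smooth_map B A \<iota>"
begin

lemma open_vimage_map: "open U \<Longrightarrow> open (\<iota> -` U)"
  using smooth_map by (simp add: smooth_map_def continuous_on_open_vimage)

lemma open_chart_overlap:
  assumes "c \<in> B" "d \<in> A" "open \<Omega>"
  shows "open (snd c ` (fst c \<inter> \<Omega> \<inter> \<iota> -` fst d))"
  unfolding Int_assoc using assms atlas_A atlas_B
  by (intro open_chart_image open_Int open_vimage_map open_chart_domain)

lemma chart_overlapE:
  assumes "c \<in> B" "y \<in> snd c ` (fst c \<inter> \<Omega> \<inter> \<iota> -` fst d)"
  obtains "cinv c y \<in> fst c" "cinv c y \<in> \<Omega>" "\<iota> (cinv c y) \<in> fst d" "snd c (cinv c y) = y"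
  using assms atlas_B by (auto simp: cinv_chart)

lemma smooth_along_cong:
  assumes "open \<Omega>" "\<And>x. x \<in> \<Omega> \<Longrightarrow> X x = Y x" "smooth_along B A \<iota> \<Omega> X"
  shows "smooth_along B A \<iota> \<Omega> Y"
  unfolding smooth_along_def
proof (intro ballI)
  fix c d assume c: "c \<in> B" and d: "d \<in> A"
  let ?S = "snd c ` (fst c \<inter> \<Omega> \<inter> \<iota> -` fst d)"
  show "smooth_on ?S (\<lambda>y. tcoord A d (\<iota> (cinv c y)) (Y (cinv c y)))"
  proof (rule smooth_on_cong)
    show "smooth_on ?S (\<lambda>y. tcoord A d (\<iota> (cinv c y)) (X (cinv c y)))"
      using assms(3) c d unfolding smooth_along_def by blast
    show "tcoord A d (\<iota> (cinv c y)) (X (cinv c y)) = tcoord A d (\<iota> (cinv c y)) (Y (cinv c y))"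
      if "y \<in> ?S" for y
      using c that assms(2) by (metis chart_overlapE)
  qed (use open_chart_overlap c d assms(1) in blast)
qed

lemma smooth_along_subset:
  assumes "smooth_along B A \<iota> \<Omega> X" "\<Omega>' \<subseteq> \<Omega>"
  shows "smooth_along B A \<iota> \<Omega>' X"
  unfolding smooth_along_def
proof (intro ballI)
  fix c d assume "c \<in> B" "d \<in> A"
  then have "smooth_on (snd c ` (fst c \<inter> \<Omega> \<inter> \<iota> -` fst d))
      (\<lambda>y. tcoord A d (\<iota> (cinv c y)) (X (cinv c y)))"
    using assms(1) unfolding smooth_along_def by blast
  then show "smooth_on (snd c ` (fst c \<inter> \<Omega>' \<inter> \<iota> -` fst d))
      (\<lambda>y. tcoord A d (\<iota> (cinv c y)) (X (cinv c y)))"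
    by (rule smooth_on_subset) (use assms(2) in blast)
qed

lemma smooth_along_Un:
  assumes "open \<Omega>" "open \<Omega>'" "smooth_along B A \<iota> \<Omega> X" "smooth_along B A \<iota> \<Omega>' X"
  shows "smooth_along B A \<iota> (\<Omega> \<union> \<Omega>') X"
  unfolding smooth_along_def
proof (intro ballI)
  fix c d assume c: "c \<in> B" and d: "d \<in> A"
  have eq: "snd c ` (fst c \<inter> (\<Omega> \<union> \<Omega>') \<inter> \<iota> -` fst d) =
      snd c ` (fst c \<inter> \<Omega> \<inter> \<iota> -` fst d) \<union> snd c ` (fst c \<inter> \<Omega>' \<inter> \<iota> -` fst d)"
    by blast
  show "smooth_on (snd c ` (fst c \<inter> (\<Omega> \<union> \<Omega>') \<inter> \<iota> -` fst d))
      (\<lambda>y. tcoord A d (\<iota> (cinv c y)) (X (cinv c y)))"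
    unfolding eq using c d assms
    by (intro smooth_on_Un open_chart_overlap) (auto simp: smooth_along_def)
qed

lemma smooth_along_zero:
  assumes "open \<Omega>"
  shows "smooth_along B A \<iota> \<Omega> (\<lambda>_. 0)"
  unfolding smooth_along_def
proof (intro ballI)
  fix c d assume c: "c \<in> B" and d: "d \<in> A"
  show "smooth_on (snd c ` (fst c \<inter> \<Omega> \<inter> \<iota> -` fst d)) (\<lambda>y. tcoord A d (\<iota> (cinv c y)) 0)"
    by (rule smooth_on_cong[OF _ _ smooth_on_const[of _ 0]])
      (use c d assms atlas_A in \<open>auto elim!: chart_overlapE
        simp: open_chart_overlap linear_0[OF linear_tcoord]\<close>)
qed

lemma smooth_along_add:
  assumes "open \<Omega>" "smooth_along B A \<iota> \<Omega> X" "smooth_along B A \<iota> \<Omega> Y"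
  shows "smooth_along B A \<iota> \<Omega> (\<lambda>x. X x + Y x)"
  unfolding smooth_along_def
proof (intro ballI)
  fix c d assume c: "c \<in> B" and d: "d \<in> A"
  let ?S = "snd c ` (fst c \<inter> \<Omega> \<inter> \<iota> -` fst d)"
  have S: "open ?S"
    using c d assms(1) by (rule open_chart_overlap)
  show "smooth_on ?S (\<lambda>y. tcoord A d (\<iota> (cinv c y)) (X (cinv c y) + Y (cinv c y)))"
  proof (rule smooth_on_cong[OF S])
    show "smooth_on ?S (\<lambda>y. tcoord A d (\<iota> (cinv c y)) (X (cinv c y)) +
        tcoord A d (\<iota> (cinv c y)) (Y (cinv c y)))"
      using assms c d by (intro smooth_on_add S) (auto simp: smooth_along_def)
  qed (use c d atlas_A in \<open>auto elim!: chart_overlapE simp: linear_add[OF linear_tcoord]\<close>)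
qed

lemma smooth_along_sum:
  assumes "open \<Omega>" "finite I" "\<And>i. i \<in> I \<Longrightarrow> smooth_along B A \<iota> \<Omega> (X i)"
  shows "smooth_along B A \<iota> \<Omega> (\<lambda>x. \<Sum>i\<in>I. X i x)"
  using assms(2,3)
  by (induction I) (auto simp: smooth_along_zero smooth_along_add assms(1))

lemma smooth_along_scaleR:
  assumes "open \<Omega>" "smooth_fun_on B \<Omega> f" "smooth_along B A \<iota> \<Omega> X"
  shows "smooth_along B A \<iota> \<Omega> (\<lambda>x. f x *\<^sub>R X x)"
  unfolding smooth_along_def
proof (intro ballI)
  fix c d assume c: "c \<in> B" and d: "d \<in> A"
  let ?S = "snd c ` (fst c \<inter> \<Omega> \<inter> \<iota> -` fst d)"
  have S: "open ?S"
    using c d assms(1) by (rule open_chart_overlap)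
  show "smooth_on ?S (\<lambda>y. tcoord A d (\<iota> (cinv c y)) (f (cinv c y) *\<^sub>R X (cinv c y)))"
  proof (rule smooth_on_cong[OF S])
    have "smooth_on (snd c ` (fst c \<inter> \<Omega>)) (\<lambda>y. f (cinv c y))"
      using assms(2) c by (simp add: smooth_fun_on_def o_def)
    then have "smooth_on ?S (\<lambda>y. f (cinv c y))"
      by (rule smooth_on_subset) blast
    then show "smooth_on ?S (\<lambda>y. f (cinv c y) *\<^sub>R tcoord A d (\<iota> (cinv c y)) (X (cinv c y)))"
      using assms(3) c d by (intro smooth_on_scaleR S) (auto simp: smooth_along_def)
  qed (use c d atlas_A in \<open>auto elim!: chart_overlapE simp: linear_scale[OF linear_tcoord]\<close>)
qed

lemma smooth_along_compose:
  assumes "open \<Omega>" "smooth_vf_on A \<Omega> Y"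
  shows "smooth_along B A \<iota> (\<iota> -` \<Omega>) (\<lambda>x. Y (\<iota> x))"
  unfolding smooth_along_def
proof (intro ballI)
  fix c d assume c: "c \<in> B" and d: "d \<in> A"
  let ?S = "snd c ` (fst c \<inter> \<iota> -` \<Omega> \<inter> \<iota> -` fst d)" and ?T = "snd d ` (fst d \<inter> \<Omega>)"
  have S: "open ?S"
    using c d open_vimage_map[OF assms(1)] by (rule open_chart_overlap)
  show "smooth_on ?S (\<lambda>y. tcoord A d (\<iota> (cinv c y)) (Y (\<iota> (cinv c y))))"
  proof (rule smooth_on_cong[OF S])
    show "smooth_on ?S (\<lambda>y. tcoord A d (cinv d ((snd d \<circ> \<iota> \<circ> cinv c) y))
        (Y (cinv d ((snd d \<circ> \<iota> \<circ> cinv c) y))))"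
    proof (rule smooth_on_compose[OF S, where f = "snd d \<circ> \<iota> \<circ> cinv c" and T = ?T])
      have "smooth_on (snd c ` (fst c \<inter> \<iota> -` fst d)) (snd d \<circ> \<iota> \<circ> cinv c)"
        using smooth_map c d unfolding smooth_map_def by blast
      then show "smooth_on ?S (snd d \<circ> \<iota> \<circ> cinv c)"
        by (rule smooth_on_subset) blast
      show "(snd d \<circ> \<iota> \<circ> cinv c) ` ?S \<subseteq> ?T"
        using c atlas_B by (auto simp: cinv_chart)
      have "smooth_on (snd d ` (fst d \<inter> \<Omega> \<inter> (\<lambda>x. x) -` fst d))
          (\<lambda>z. tcoord A d (cinv d z) (Y (cinv d z)))"
        using assms(2) d unfolding smooth_vf_on_def smooth_along_def by blast
      then show "smooth_on ?T (\<lambda>z. tcoord A d (cinv d z) (Y (cinv d z)))"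
        by (rule smooth_on_subset) auto
    qed
    show "tcoord A d (cinv d ((snd d \<circ> \<iota> \<circ> cinv c) y)) (Y (cinv d ((snd d \<circ> \<iota> \<circ> cinv c) y))) =
        tcoord A d (\<iota> (cinv c y)) (Y (\<iota> (cinv c y)))" if "y \<in> ?S" for y
      using that c d atlas_A atlas_B by (auto simp: cinv_chart)
  qed
qed

lemma smooth_fun_coord:
  assumes "d \<in> A" "smooth_along B A \<iota> \<Omega> X" "open \<Omega>"
  shows "smooth_fun_on B (\<Omega> \<inter> \<iota> -` fst d) (\<lambda>x. tcoord A d (\<iota> x) (X x) \<bullet> b)"
  unfolding smooth_fun_on_def o_def
proof
  fix c assume c: "c \<in> B"
  let ?S = "snd c ` (fst c \<inter> \<Omega> \<inter> \<iota> -` fst d)"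
  have "smooth_on ?S (\<lambda>y. tcoord A d (\<iota> (cinv c y)) (X (cinv c y)))"
    using assms c unfolding smooth_along_def by blast
  then have "smooth_on ?S (\<lambda>y. tcoord A d (\<iota> (cinv c y)) (X (cinv c y)) \<bullet> b)"
    by (rule smooth_on_bounded_linear[OF bounded_linear_inner_left open_chart_overlap[OF c assms(1,3)]])
  then show "smooth_on (snd c ` (fst c \<inter> (\<Omega> \<inter> \<iota> -` fst d)))
      (\<lambda>y. tcoord A d (\<iota> (cinv c y)) (X (cinv c y)) \<bullet> b)"
    by (simp only: Int_assoc)
qed

lemma smooth_fun_on_const: "smooth_fun_on B \<Omega> (\<lambda>_. k)"
  by (simp add: smooth_fun_on_def o_def smooth_on_const)

lemma smooth_fun_on_cong:
  assumes "open \<Omega>" "\<And>x. x \<in> \<Omega> \<Longrightarrow> f x = h x" "smooth_fun_on B \<Omega> f"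
  shows "smooth_fun_on B \<Omega> h"
  unfolding smooth_fun_on_def
proof
  fix c assume c: "c \<in> B"
  have "open (snd c ` (fst c \<inter> \<Omega>))"
    using c assms(1) atlas_B by (intro open_chart_image)
  moreover have "smooth_on (snd c ` (fst c \<inter> \<Omega>)) (f \<circ> cinv c)"
    using assms(3) c by (simp add: smooth_fun_on_def)
  moreover have "(f \<circ> cinv c) y = (h \<circ> cinv c) y" if "y \<in> snd c ` (fst c \<inter> \<Omega>)" for y
    using that c atlas_B assms(2) by (auto simp: cinv_chart)
  ultimately show "smooth_on (snd c ` (fst c \<inter> \<Omega>)) (h \<circ> cinv c)"
    using smooth_on_cong by blast
qed

lemma dir_deriv_locally_const:
  assumes "open \<Omega>" "x \<in> \<Omega>" "\<And>y. y \<in> \<Omega> \<Longrightarrow> f y = k"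
  shows "dir_deriv B x w f = 0"
proof -
  let ?c = "chart_at B x"
  note c = atlas_chart_at[OF atlas_B, of x]
  have "((\<lambda>_. k) has_derivative (\<lambda>_. 0)) (at (snd ?c x))"
    by simp
  then have "((f \<circ> cinv ?c) has_derivative (\<lambda>_. 0)) (at (snd ?c x))"
    by (rule has_derivative_transform_within_open[where s = "snd ?c ` (fst ?c \<inter> \<Omega>)"])
      (use assms c atlas_B in \<open>auto simp: cinv_chart open_chart_image\<close>)
  then show ?thesis
    by (simp add: dir_deriv_def frechet_derivative_at[symmetric])
qed

end


section \<open>The pull-back connection\<close>

lemma
  assumes D: "pullback_connection B A \<iota> nabla D" and \<Omega>: "open \<Omega>" "x \<in> \<Omega>"
  shows pullback_connection_add:
      "smooth_along B A \<iota> \<Omega> U \<Longrightarrow> smooth_along B A \<iota> \<Omega> V \<Longrightarrow>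
        D x w (\<lambda>y. U y + V y) = D x w U + D x w V"
    and pullback_connection_scaleR:
      "smooth_fun_on B \<Omega> f \<Longrightarrow> smooth_along B A \<iota> \<Omega> U \<Longrightarrow>
        D x w (\<lambda>y. f y *\<^sub>R U y) = dir_deriv B x w f *\<^sub>R U x + f x *\<^sub>R D x w U"
  using D[unfolded pullback_connection_def, THEN conjunct2, THEN conjunct1]
    D[unfolded pullback_connection_def, THEN conjunct2, THEN conjunct2, THEN conjunct1] \<Omega>
  by simp_all

lemma pullback_connection_compose:
  assumes D: "pullback_connection B A \<iota> nabla D" and "open \<Omega>" "\<iota> x \<in> \<Omega>" "smooth_vf_on A \<Omega> Y"
  shows "D x w (\<lambda>y. Y (\<iota> y)) = nabla (\<iota> x) (tangent_map B A \<iota> x w) Y"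
  using D[unfolded pullback_connection_def, THEN conjunct2, THEN conjunct2, THEN conjunct2] assms(2-4)
  by simp

context manifold_map
begin

text \<open>
  The covariant derivative depends only on the germ of the field: the indicator function of \<open>\<Omega>\<close> is
  smooth on \<open>\<Omega>\<close> with zero derivative, so by the Leibniz rule multiplication by it changes nothing,
  and it makes the two fields equal everywhere.
\<close>

lemma pullback_connection_local:
  assumes D: "pullback_connection B A \<iota> nabla D"
    and \<Omega>: "open \<Omega>" "x \<in> \<Omega>" and U: "smooth_along B A \<iota> \<Omega> U"
    and eq: "\<And>y. y \<in> \<Omega> \<Longrightarrow> U y = V y"
  shows "D x w U = D x w V"
proof -
  let ?f = "\<lambda>y. if y \<in> \<Omega> then 1 else 0 :: real"
  have f: "smooth_fun_on B \<Omega> ?f"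
    by (rule smooth_fun_on_cong[OF \<Omega>(1) _ smooth_fun_on_const[of _ 1]]) simp
  have df: "dir_deriv B x w ?f = 0"
    by (rule dir_deriv_locally_const[OF \<Omega>, of _ 1]) simp
  have cut_off: "D x w (\<lambda>y. ?f y *\<^sub>R Z y) = D x w Z" if "smooth_along B A \<iota> \<Omega> Z" for Z
  proof -
    have "D x w (\<lambda>y. ?f y *\<^sub>R Z y) = dir_deriv B x w ?f *\<^sub>R Z x + ?f x *\<^sub>R D x w Z"
      using f that by (rule pullback_connection_scaleR[OF D \<Omega>])
    then show ?thesis
      using df \<Omega> by simp
  qed
  have V: "smooth_along B A \<iota> \<Omega> V"
    using \<Omega>(1) eq U by (rule smooth_along_cong)
  have "D x w U = D x w (\<lambda>y. ?f y *\<^sub>R U y)"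
    by (rule cut_off[OF U, symmetric])
  also have "(\<lambda>y. ?f y *\<^sub>R U y) = (\<lambda>y. ?f y *\<^sub>R V y)"
    using eq by auto
  also have "D x w \<dots> = D x w V"
    by (rule cut_off[OF V])
  finally show ?thesis .
qed

lemma pullback_connection_sum:
  assumes D: "pullback_connection B A \<iota> nabla D"
    and \<Omega>: "open \<Omega>" "x \<in> \<Omega>" and \<Omega>': "open \<Omega>'" "\<Omega> \<subseteq> \<iota> -` \<Omega>'" and I: "finite I"
    and f: "\<And>i. i \<in> I \<Longrightarrow> smooth_fun_on B \<Omega> (f i)"
    and Y: "\<And>i. i \<in> I \<Longrightarrow> smooth_vf_on A \<Omega>' (Y i)"
  shows "D x w (\<lambda>y. \<Sum>i\<in>I. f i y *\<^sub>R Y i (\<iota> y)) =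
    (\<Sum>i\<in>I. dir_deriv B x w (f i) *\<^sub>R Y i (\<iota> x) +
      f i x *\<^sub>R nabla (\<iota> x) (tangent_map B A \<iota> x w) (Y i))"
  using I f Y
proof (induction I)
  case empty
  have "D x w (\<lambda>y. 0 + 0) = D x w (\<lambda>_. 0) + D x w (\<lambda>_. 0)"
    using smooth_along_zero[OF \<Omega>(1)] smooth_along_zero[OF \<Omega>(1)]
    by (rule pullback_connection_add[OF D \<Omega>])
  then show ?case by simp
next
  case (insert i I)
  have Y: "smooth_along B A \<iota> \<Omega> (\<lambda>y. Y j (\<iota> y))" if "j \<in> insert i I" for j
    using smooth_along_compose[OF \<Omega>'(1) insert.prems(2)[OF that]] \<Omega>'(2)
    by (rule smooth_along_subset)
  have fY: "smooth_along B A \<iota> \<Omega> (\<lambda>y. f j y *\<^sub>R Y j (\<iota> y))" if "j \<in> insert i I" for j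
    using insert.prems(1)[OF that] Y[OF that] by (rule smooth_along_scaleR[OF \<Omega>(1)])
  have "D x w (\<lambda>y. f i y *\<^sub>R Y i (\<iota> y)) =
      dir_deriv B x w (f i) *\<^sub>R Y i (\<iota> x) + f i x *\<^sub>R D x w (\<lambda>y. Y i (\<iota> y))"
    using insert.prems(1)[OF insertI1] Y[OF insertI1] by (rule pullback_connection_scaleR[OF D \<Omega>])
  moreover have "D x w (\<lambda>y. Y i (\<iota> y)) = nabla (\<iota> x) (tangent_map B A \<iota> x w) (Y i)"
    using \<Omega>' \<Omega>(2) insert.prems(2)[OF insertI1] by (intro pullback_connection_compose[OF D]) auto
  moreover have "D x w (\<lambda>y. f i y *\<^sub>R Y i (\<iota> y) + (\<Sum>j\<in>I. f j y *\<^sub>R Y j (\<iota> y))) =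
      D x w (\<lambda>y. f i y *\<^sub>R Y i (\<iota> y)) + D x w (\<lambda>y. \<Sum>j\<in>I. f j y *\<^sub>R Y j (\<iota> y))"
    using fY[OF insertI1] smooth_along_sum[OF \<Omega>(1) insert.hyps(1) fY[OF insertI2]]
    by (rule pullback_connection_add[OF D \<Omega>])
  ultimately show ?case
    using insert by simp
qed

text \<open>
  Parallelism of \<open>J\<close> is a statement about fields on the ambient manifold. It passes to fields along
  \<open>\<iota>\<close> because such a field is locally a combination, with smooth coefficients on the source, of
  coordinate fields \<open>E\<^sub>b \<circ> \<iota>\<close>; both sides are then computed by the same Leibniz formula.
\<close>

lemma pullback_connection_parallel:
  assumes D: "pullback_connection B A \<iota> nabla D"
    and J: "parallel_endomorphism A nabla J" "\<And>m. linear (J m)"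
      "\<And>\<Omega> Y. open \<Omega> \<Longrightarrow> smooth_vf_on A \<Omega> Y \<Longrightarrow> smooth_vf_on A \<Omega> (\<lambda>m. J m (Y m))"
    and \<Omega>: "open \<Omega>" "x \<in> \<Omega>" and U: "smooth_along B A \<iota> \<Omega> U"
  shows "D x w (\<lambda>y. J (\<iota> y) (U y)) = J (\<iota> x) (D x w U)"
proof -
  let ?d = "chart_at A (\<iota> x)"
  define E where "E = coord_field A ?d"
  define f where "f b y = tcoord A ?d (\<iota> y) (U y) \<bullet> b" for b y
  define \<Omega>' where "\<Omega>' = \<Omega> \<inter> \<iota> -` fst ?d"
  define v where "v = tangent_map B A \<iota> x w"
  note d = atlas_chart_at[OF atlas_A, of "\<iota> x"]
  have dom: "open (fst ?d)"
    using atlas_A d(1) by (rule open_chart_domain)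
  have \<Omega>': "open \<Omega>'" "x \<in> \<Omega>'" "\<Omega>' \<subseteq> \<iota> -` fst ?d"
    using \<Omega> d(2) open_vimage_map[OF dom] by (auto simp: \<Omega>'_def)
  have f: "smooth_fun_on B \<Omega>' (f b)" for b
    unfolding f_def \<Omega>'_def using d(1) U \<Omega>(1) by (rule smooth_fun_coord)
  have E: "smooth_vf_on A (fst ?d) (E b)" for b
    unfolding E_def using atlas_A d(1) by (rule smooth_coord_field)
  have JE: "smooth_vf_on A (fst ?d) (\<lambda>m. J m (E b m))" for b
    using dom E by (rule J(3))
  have nabla_JE: "nabla (\<iota> x) v (\<lambda>m. J m (E b m)) = J (\<iota> x) (nabla (\<iota> x) v (E b))" for b
    using J(1) dom d(2) E unfolding parallel_endomorphism_def by (metis right_minus_eq)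
  have U_eq: "U y = (\<Sum>b\<in>Basis. f b y *\<^sub>R E b (\<iota> y))" if "y \<in> \<Omega>'" for y
    using that coord_field_expansion[OF atlas_A d(1), of "\<iota> y" "U y"]
    by (simp add: f_def E_def \<Omega>'_def)
  have JU_eq: "J (\<iota> y) (U y) = (\<Sum>b\<in>Basis. f b y *\<^sub>R J (\<iota> y) (E b (\<iota> y)))" if "y \<in> \<Omega>'" for y
    unfolding U_eq[OF that] by (simp only: linear_sum[OF J(2)] linear_scale[OF J(2)])
  have smooth: "smooth_along B A \<iota> \<Omega>' (\<lambda>y. \<Sum>b\<in>Basis. f b y *\<^sub>R Z b (\<iota> y))"
    if "\<And>b. smooth_vf_on A (fst ?d) (Z b)" for Z
    using smooth_along_compose[OF dom that] smooth_along_subset[OF _ \<Omega>'(3)]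
    by (intro smooth_along_sum smooth_along_scaleR \<Omega>'(1) f) auto
  have "D x w (\<lambda>y. J (\<iota> y) (U y)) = D x w (\<lambda>y. \<Sum>b\<in>Basis. f b y *\<^sub>R J (\<iota> y) (E b (\<iota> y)))"
    by (rule pullback_connection_local[OF D \<Omega>'(1,2) smooth[OF JE], symmetric])
      (rule JU_eq[symmetric])
  also have "\<dots> = (\<Sum>b\<in>Basis. dir_deriv B x w (f b) *\<^sub>R J (\<iota> x) (E b (\<iota> x)) +
      f b x *\<^sub>R J (\<iota> x) (nabla (\<iota> x) v (E b)))"
    using pullback_connection_sum[OF D \<Omega>'(1,2) dom \<Omega>'(3) finite_Basis, of f "\<lambda>b m. J m (E b m)", OF f JE]
    by (simp add: nabla_JE flip: v_def)
  also have "\<dots> = J (\<iota> x) (\<Sum>b\<in>Basis. dir_deriv B x w (f b) *\<^sub>R E b (\<iota> x) +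
      f b x *\<^sub>R nabla (\<iota> x) v (E b))"
    by (simp only: linear_sum[OF J(2)] linear_scale[OF J(2)] linear_add[OF J(2)])
  also have "(\<Sum>b\<in>Basis. dir_deriv B x w (f b) *\<^sub>R E b (\<iota> x) + f b x *\<^sub>R nabla (\<iota> x) v (E b)) =
      D x w (\<lambda>y. \<Sum>b\<in>Basis. f b y *\<^sub>R E b (\<iota> y))"
    using pullback_connection_sum[OF D \<Omega>'(1,2) dom \<Omega>'(3) finite_Basis, of f E, OF f E]
    by (simp flip: v_def)
  also have "\<dots> = D x w U"
    by (rule pullback_connection_local[OF D \<Omega>'(1,2) smooth[OF E]]) (rule U_eq[symmetric])
  finally show ?thesis .
qed

end

section \<open>Global sections through a given vector\<close>

lemma local_section_extends:
  fixes B :: "('n::t2_space, 'f::euclidean_space) chart set"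
  assumes "manifold_map B A \<iota>"
    and \<Omega>: "open \<Omega>" "x \<in> \<Omega>" and X: "smooth_along B A \<iota> \<Omega> X"
    and E: "\<And>y. subspace (E y)" "\<And>y. y \<in> \<Omega> \<Longrightarrow> X y \<in> E y"
  shows "\<exists>Y \<in> sections B A \<iota> E. Y x = X x"
proof -
  interpret manifold_map B A \<iota> by fact
  let ?c = "chart_at B x"
  note c = atlas_chart_at[OF atlas_B, of x]
  let ?V = "snd ?c ` (fst ?c \<inter> \<Omega>)"
  have "open ?V" "snd ?c x \<in> ?V"
    using atlas_B c \<Omega> by (auto simp: open_chart_image)
  then obtain \<epsilon> where \<epsilon>: "\<epsilon> > 0" "cball (snd ?c x) \<epsilon> \<subseteq> ?V"
    using open_contains_cball by blast
  obtain \<beta> :: "'f \<Rightarrow> real" where \<beta>: "smooth_on UNIV \<beta>" "\<beta> (snd ?c x) = 1"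
    "\<And>z. z \<notin> ball (snd ?c x) \<epsilon> \<Longrightarrow> \<beta> z = 0"
    using exists_bump_function[OF \<epsilon>(1)] by metis
  define K where "K = cinv ?c ` cball (snd ?c x) \<epsilon>"
  have K: "K \<subseteq> fst ?c \<inter> \<Omega>"
    using \<epsilon>(2) atlas_B c by (force simp: K_def cinv_chart)
  have "continuous_on (cball (snd ?c x) \<epsilon>) (cinv ?c)"
    using continuous_on_cinv[OF atlas_B c(1)] by (rule continuous_on_subset) (use \<epsilon>(2) in blast)
  then have "closed K"
    unfolding K_def by (intro compact_imp_closed compact_continuous_image) auto
  then have oK: "open (- K)" by blast
  \<comment> \<open>\<open>Y\<close> is smooth near \<open>K\<close> as a product and zero on the complement of \<open>K\<close>, which is open
    because the source is Hausdorff\<close>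
  define Y where "Y y = (if y \<in> K then \<beta> (snd ?c y) *\<^sub>R X y else 0)" for y
  have Y_eq: "Y y = \<beta> (snd ?c y) *\<^sub>R X y" if "y \<in> fst ?c" for y
  proof (cases "y \<in> K")
    case False
    then have "snd ?c y \<notin> ball (snd ?c x) \<epsilon>"
      using cinv_chart[OF atlas_B c(1) that] ball_subset_cball unfolding K_def by (metis image_eqI subsetD)
    then show ?thesis by (simp add: \<beta>(3) Y_def)
  qed (simp add: Y_def)
  let ?\<Omega> = "fst ?c \<inter> \<Omega>"
  have o: "open ?\<Omega>"
    using \<Omega>(1) open_chart_domain[OF atlas_B c(1)] by blast
  have "smooth_fun_on B ?\<Omega> (\<lambda>y. \<beta> (snd ?c y))"
    unfolding smooth_fun_on_def o_def
  proof
    fix d assume d: "d \<in> B"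
    show "smooth_on (snd d ` (fst d \<inter> ?\<Omega>)) (\<lambda>z. \<beta> (snd ?c (cinv d z)))"
    proof (rule smooth_on_compose[where f = "\<lambda>z. snd ?c (cinv d z)" and T = UNIV])
      show "open (snd d ` (fst d \<inter> ?\<Omega>))"
        using atlas_B d o by (rule open_chart_image)
      have "smooth_on (snd d ` (fst d \<inter> fst ?c)) (snd ?c \<circ> cinv d)"
        using atlas_B c d unfolding smooth_atlas_def by blast
      then show "smooth_on (snd d ` (fst d \<inter> ?\<Omega>)) (\<lambda>z. snd ?c (cinv d z))"
        unfolding o_def by (rule smooth_on_subset) blast
    qed (use \<beta>(1) in auto)
  qed
  then have "smooth_along B A \<iota> ?\<Omega> (\<lambda>y. \<beta> (snd ?c y) *\<^sub>R X y)"
    using smooth_along_subset[OF X] by (intro smooth_along_scaleR o) auto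
  then have "smooth_along B A \<iota> ?\<Omega> Y"
    by (rule smooth_along_cong[OF o, rotated]) (simp add: Y_eq)
  moreover have "smooth_along B A \<iota> (- K) Y"
    by (rule smooth_along_cong[OF oK _ smooth_along_zero[OF oK]]) (simp add: Y_def)
  ultimately have "smooth_along B A \<iota> (?\<Omega> \<union> - K) Y"
    using o oK smooth_along_Un by blast
  moreover have "?\<Omega> \<union> - K = UNIV"
    using K by blast
  ultimately have "smooth_along B A \<iota> UNIV Y" by simp
  moreover have "Y y \<in> E y" for y
    using E K by (auto simp: Y_def subspace_scale subspace_0)
  moreover have "Y x = X x"
    using c \<beta>(2) by (simp add: Y_eq)
  ultimately show ?thesis
    unfolding sections_def by blast
qed

lemma smooth_subbundle_subspace:
  assumes "smooth_subbundle B A \<iota> k E"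
  shows "subspace (E x)"
proof -
  obtain \<Omega> e where "x \<in> \<Omega>" "local_frame B A \<iota> k E \<Omega> e"
    using assms unfolding smooth_subbundle_def by blast
  then show ?thesis
    unfolding local_frame_def by (metis subspace_span)
qed

text \<open>
  A vector of a fibre is a combination of the local frame with constant coefficients; multiplied by a
  bump function this extends to a global section. This lets conditions on all sections of a bundle be
  tested on single vectors.
\<close>

lemma section_through:
  fixes B :: "('n::t2_space, 'f::euclidean_space) chart set"
  assumes "manifold_map B A \<iota>" "smooth_subbundle B A \<iota> k E" "v \<in> E x"
  shows "\<exists>X \<in> sections B A \<iota> E. X x = v"
proof -
  interpret manifold_map B A \<iota> by fact
  obtain \<Omega> e where \<Omega>: "open \<Omega>" "x \<in> \<Omega>" and e: "local_frame B A \<iota> k E \<Omega> e"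
    using assms(2) unfolding smooth_subbundle_def by blast
  have inj: "inj_on (\<lambda>i. e i x) {..<k}" and span: "\<And>y. y \<in> \<Omega> \<Longrightarrow> span ((\<lambda>i. e i y) ` {..<k}) = E y"
    and smooth: "\<And>i. i < k \<Longrightarrow> smooth_along B A \<iota> \<Omega> (e i)"
    using e \<Omega>(2) by (auto simp: local_frame_def)
  have "v \<in> span ((\<lambda>i. e i x) ` {..<k})"
    using span \<Omega>(2) assms(3) by blast
  then obtain u where u: "v = (\<Sum>w\<in>(\<lambda>i. e i x) ` {..<k}. u w *\<^sub>R w)"
    using span_finite[of "(\<lambda>i. e i x) ` {..<k}"] by auto
  define X where "X y = (\<Sum>i<k. u (e i x) *\<^sub>R e i y)" for y
  have "X x = v"
    by (simp add: X_def u sum.reindex[OF inj])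
  moreover have "smooth_along B A \<iota> \<Omega> X"
    unfolding X_def using smooth
    by (intro smooth_along_sum smooth_along_scaleR smooth_fun_on_const \<Omega>(1)) auto
  moreover have "X y \<in> E y" if "y \<in> \<Omega>" for y
    unfolding X_def span[OF that, symmetric] by (intro span_sum span_scale span_base) auto
  ultimately show ?thesis
    using local_section_extends[OF assms(1) \<Omega>, of X E] smooth_subbundle_subspace[OF assms(2)] by metis
qed


section \<open>Linear algebra of the Gauss and Weingarten decomposition\<close>

lemma dim_bilinear_orthogonal:
  fixes b :: "'e::euclidean_space \<Rightarrow> 'e \<Rightarrow> real"
  assumes b: "bilinear b" and nondeg: "nondegenerate_on b UNIV" and T: "subspace T"
  shows "dim {v. \<forall>u\<in>T. b v u = 0} + dim T = DIM('e)"
proof -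
  define G where "G v = (\<Sum>i\<in>Basis. b v i *\<^sub>R i)" for v
  have b1: "linear (\<lambda>v. b v u)" and b2: "linear (b v)" for u v
    using b by (auto simp: bilinear_def)
  have G: "G v \<bullet> u = b v u" for v u
  proof -
    have "b v u = b v (\<Sum>i\<in>Basis. (u \<bullet> i) *\<^sub>R i)"
      by (simp only: euclidean_representation)
    also have "\<dots> = (\<Sum>i\<in>Basis. (u \<bullet> i) * b v i)"
      by (simp only: linear_sum[OF b2] linear_scale[OF b2] real_scaleR_def)
    finally show ?thesis
      by (simp add: G_def inner_sum_left inner_commute[of u] mult.commute)
  qed
  have G': "u \<bullet> G v = b v u" for v u
    using G[of v u] by (simp add: inner_commute)
  have lin: "linear G"
    by (rule linearI)
      (simp_all add: G_def linear_add[OF b1] linear_scale[OF b1] algebra_simps sum.distrib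
        scaleR_sum_right)
  have "v = 0" if "G v = 0" for v
    using nondeg that G[of v] by (simp add: nondegenerate_on_def)
  then have inj: "inj G"
    using linear_injective_0[OF lin] by blast
  then have "surj G"
    using lin linear_injective_imp_surjective by blast
  let ?P = "{v. \<forall>u\<in>T. b v u = 0}"
  have "G ` ?P = {y \<in> UNIV. \<forall>u\<in>T. orthogonal u y}"
  proof (intro equalityI subsetI)
    fix y assume y: "y \<in> {y \<in> UNIV. \<forall>u\<in>T. orthogonal u y}"
    obtain v where "y = G v"
      using \<open>surj G\<close> by (metis surjD)
    moreover have "b v u = 0" if "u \<in> T" for u
      using y that \<open>y = G v\<close> by (simp add: orthogonal_def G')
    ultimately show "y \<in> G ` ?P"
      by blast
  qed (auto simp: orthogonal_def G')
  then have "dim ?P = dim {y \<in> UNIV. \<forall>u\<in>T. orthogonal u y}"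
    using dim_image_eq[OF lin inj_on_subset[OF inj subset_UNIV], of ?P] by simp
  then show ?thesis
    using dim_subspace_orthogonal_to_vectors[OF T subspace_UNIV subset_UNIV] by simp
qed

text \<open>
  The whole space is the direct sum of \<open>T\<close>, \<open>L\<close> and \<open>Z\<close>, so that the definite description in
  \<open>gw_components\<close> has its intended value. The sums are direct because \<open>L\<close> pairs non-degenerately with
  the radical \<open>T \<inter> P\<close>, which annihilates \<open>T + Z\<close>; the dimensions then add up to the full dimension.
\<close>

lemma gauss_weingarten_decomposition:
  fixes b :: "'e::euclidean_space \<Rightarrow> 'e \<Rightarrow> real"
  assumes b: "bilinear b" "\<And>v w. b v w = b w v" "nondegenerate_on b UNIV"
    and subspaces: "subspace T" "subspace L" "subspace Z"
    and P: "P = {v. \<forall>u\<in>T. b v u = 0}"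
    and Z: "is_direct_sum (T \<inter> P) Z P"
    and L: "dim L = dim (T \<inter> P)" "\<And>n. n \<in> L \<Longrightarrow> (\<And>\<xi>. \<xi> \<in> T \<inter> P \<Longrightarrow> b n \<xi> = 0) \<Longrightarrow> n = 0"
    and components: "gw_components T L Z v = (t, l, z)"
  shows "t \<in> T" "l \<in> L" "z \<in> Z" "v = t + l + z"
proof -
  have sub_P: "subspace P"
    unfolding P using b(1)
    by (auto simp: subspace_def bilinear_lzero bilinear_ladd bilinear_lmul)
  have Z_P: "Z \<subseteq> P" "T \<inter> Z = {0}"
  proof -
    have "0 \<in> T \<inter> P"
      using sub_P subspaces(1) by (simp add: subspace_0)
    then show "Z \<subseteq> P"
      using Z unfolding is_direct_sum_def by force
    then show "T \<inter> Z = {0}"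
      using Z unfolding is_direct_sum_def by blast
  qed
  let ?TZ = "{x + y |x y. x \<in> T \<and> y \<in> Z}" and ?RZ = "{x + y |x y. x \<in> T \<inter> P \<and> y \<in> Z}"
  let ?sum = "{x + y |x y. x \<in> L \<and> y \<in> ?TZ}"
  have TZ: "subspace ?TZ"
    using subspaces subspace_sums by blast
  have L_TZ: "L \<inter> ?TZ = {0}"
  proof (intro equalityI subsetI)
    fix n assume n: "n \<in> L \<inter> ?TZ"
    then obtain x y where xy: "n = x + y" "x \<in> T" "y \<in> P"
      using Z_P(1) by blast
    have "b n \<xi> = 0" if "\<xi> \<in> T \<inter> P" for \<xi>
      using that xy b(2)[of x \<xi>] by (auto simp: P bilinear_ladd[OF b(1)])
    then show "n \<in> {0}"
      using L(2) n by blast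
  qed (use subspace_0[OF subspaces(2)] subspace_0[OF TZ] in blast)
  have "dim ?TZ = dim T + dim Z"
    using dim_sums_Int[OF subspaces(1,3)] Z_P(2) by simp
  moreover have "dim P = dim (T \<inter> P) + dim Z"
    using dim_sums_Int[OF subspace_inter[OF subspaces(1) sub_P] subspaces(3)] Z by (simp add: is_direct_sum_def)
  moreover have "dim P + dim T = DIM('e)"
    unfolding P using b(1,3) subspaces(1) by (rule dim_bilinear_orthogonal)
  moreover have "dim ?sum = dim L + dim ?TZ"
    using dim_sums_Int[OF subspaces(2) TZ] L_TZ by simp
  ultimately have "dim ?sum = DIM('e)"
    using L(1) by linarith
  then have "span ?sum = UNIV"
    by (simp only: dim_eq_full)
  moreover have "span ?sum = ?sum"
    using subspace_sums[OF subspaces(2) TZ] by (simp only: span_eq_iff)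
  ultimately have "v \<in> ?sum" by blast
  then obtain l0 w where "l0 \<in> L" "w \<in> ?TZ" "v = l0 + w"
    by blast
  moreover from this(2) obtain t0 z0 where "t0 \<in> T" "z0 \<in> Z" "w = t0 + z0"
    by blast
  ultimately have v: "t0 \<in> T" "l0 \<in> L" "z0 \<in> Z" "v = t0 + l0 + z0"
    by (simp_all add: algebra_simps)
  have unique: "a = t0 \<and> m = l0 \<and> c = z0"
    if "a \<in> T \<and> m \<in> L \<and> c \<in> Z \<and> v = a + m + c" for a m c
  proof -
    have eq: "m - l0 = (t0 - a) + (z0 - c)"
      using that v by (simp add: algebra_simps)
    have "m - l0 \<in> L" "t0 - a \<in> T" "z0 - c \<in> Z"
      using that v subspaces by (auto intro: subspace_diff)
    then have "m - l0 \<in> L \<inter> ?TZ"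
      using eq by blast
    then have m: "m = l0"
      using L_TZ by simp
    then have diff: "t0 - a = c - z0"
      using eq by (simp add: algebra_simps)
    then have "t0 - a \<in> T \<inter> Z"
      using that v subspaces by (metis IntI subspace_diff)
    then have "t0 - a = 0"
      unfolding Z_P(2) by blast
    with diff m show ?thesis
      by simp
  qed
  have "gw_components T L Z v = (t0, l0, z0)"
    unfolding gw_components_def
  proof (rule the_equality)
    show "case (t0, l0, z0) of (a, m, c) \<Rightarrow> a \<in> T \<and> m \<in> L \<and> c \<in> Z \<and> v = a + m + c"
      unfolding prod.case using v by (intro conjI)
    show "y = (t0, l0, z0)" if "case y of (a, m, c) \<Rightarrow> a \<in> T \<and> m \<in> L \<and> c \<in> Z \<and> v = a + m + c" for y
    proof (cases y)
      case (fields a m c)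
      with that have "a \<in> T \<and> m \<in> L \<and> c \<in> Z \<and> v = a + m + c"
        by (simp only: prod.case)
      from unique[OF this] fields show ?thesis
        by simp
    qed
  qed
  then show "t \<in> T" "l \<in> L" "z \<in> Z" "v = t + l + z"
    using v components by simp_all
qed

lemma dual_frame_span_eq_0:
  fixes b :: "'e::real_vector \<Rightarrow> 'e \<Rightarrow> real" and r :: nat
  assumes b: "bilinear b" and dual: "\<And>i j. i < r \<Longrightarrow> j < r \<Longrightarrow> b (e i) (f j) = (if i = j then 1 else 0)"
    and e: "inj_on e {..<r}" and v: "v \<in> span (e ` {..<r})"
    and zero: "\<And>j. j < r \<Longrightarrow> b v (f j) = 0"
  shows "v = 0"
proof -
  have "v \<in> range (\<lambda>u. \<Sum>w\<in>e ` {..<r}. u w *\<^sub>R w)"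
    using v by (simp only: span_finite[OF finite_imageI[OF finite_lessThan]])
  then obtain u where "v = (\<Sum>w\<in>e ` {..<r}. u w *\<^sub>R w)"
    by (rule rangeE)
  then have v_eq: "v = (\<Sum>i<r. u (e i) *\<^sub>R e i)"
    by (simp add: sum.reindex[OF e])
  have "u (e j) = 0" if "j < r" for j
  proof -
    have lin: "linear (\<lambda>x. b x (f j))"
      using b by (simp add: bilinear_def)
    have "b v (f j) = (\<Sum>i<r. u (e i) * b (e i) (f j))"
      by (simp only: v_eq linear_sum[OF lin] linear_scale[OF lin] real_scaleR_def)
    also have "\<dots> = (\<Sum>i<r. if i = j then u (e i) else 0)"
      using dual that by (intro sum.cong) auto
    also have "\<dots> = u (e j)"
      using that by simp
    finally show ?thesis
      using zero[OF that] by simp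
  qed
  then show ?thesis
    by (simp add: v_eq)
qed

section \<open>The lightlike transversal bundle\<close>

lemma lightlike_transversal_frames:
  assumes "smooth_subbundle B A \<iota> r (Rad B A g \<iota>)" "lightlike_transversal_bundle B A g \<iota> r S Str ltr"
  obtains \<Omega> \<xi> N where "open \<Omega>" "x \<in> \<Omega>" "local_frame B A \<iota> r ltr \<Omega> N"
    "inj_on (\<lambda>i. \<xi> i x) {..<r}" "independent ((\<lambda>i. \<xi> i x) ` {..<r})"
    "span ((\<lambda>i. \<xi> i x) ` {..<r}) = Rad B A g \<iota> x"
    "\<And>i j. i < r \<Longrightarrow> j < r \<Longrightarrow> g (\<iota> x) (\<xi> i x) (N j x) = (if i = j then 1 else 0)"
    "\<And>i j. i < r \<Longrightarrow> j < r \<Longrightarrow> g (\<iota> x) (N i x) (N j x) = 0"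
proof -
  obtain \<Omega> \<xi> where \<xi>: "open \<Omega>" "x \<in> \<Omega>" "local_frame B A \<iota> r (Rad B A g \<iota>) \<Omega> \<xi>"
    using assms(1) unfolding smooth_subbundle_def by blast
  have "\<exists>\<Omega>' N. open \<Omega>' \<and> x \<in> \<Omega>' \<and> \<Omega>' \<subseteq> \<Omega> \<and> local_frame B A \<iota> r ltr \<Omega>' N \<and>
      (\<forall>y\<in>\<Omega>'. \<forall>i<r. \<forall>j<r. g (\<iota> y) (\<xi> i y) (N j y) = (if i = j then 1 else 0) \<and>
        g (\<iota> y) (N i y) (N j y) = 0)"
    using assms(2)[unfolded lightlike_transversal_bundle_def, THEN conjunct2, rule_format, OF \<xi>(1,3,2)] .
  then obtain \<Omega>' N where N: "open \<Omega>'" "x \<in> \<Omega>'" "local_frame B A \<iota> r ltr \<Omega>' N"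
    "\<forall>y\<in>\<Omega>'. \<forall>i<r. \<forall>j<r. g (\<iota> y) (\<xi> i y) (N j y) = (if i = j then 1 else 0) \<and>
      g (\<iota> y) (N i y) (N j y) = 0"
    by blast
  show thesis
    by (rule that[of \<Omega>' N \<xi>, OF N(1-3)]) (use \<xi>(2,3) N(2,4) in \<open>simp_all add: local_frame_def\<close>)
qed

lemma lightlike_transversal_smooth_subbundle:
  assumes "smooth_subbundle B A \<iota> r (Rad B A g \<iota>)" "lightlike_transversal_bundle B A g \<iota> r S Str ltr"
  shows "smooth_subbundle B A \<iota> r ltr"
  unfolding smooth_subbundle_def
proof
  fix x
  obtain \<Omega> N where "open \<Omega>" "x \<in> \<Omega>" "local_frame B A \<iota> r ltr \<Omega> N"
    using lightlike_transversal_frames[OF assms, of x] by metis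
  then show "\<exists>\<Omega> e. open \<Omega> \<and> x \<in> \<Omega> \<and> local_frame B A \<iota> r ltr \<Omega> e"
    by blast
qed

text \<open>
  The bundle \<open>ltr\<close> is totally isotropic and dual to the radical. Since the pairing of the two is
  non-degenerate on both sides, it identifies each with the dual of the other.
\<close>

lemma lightlike_transversal_duality:
  assumes g: "bilinear (g (\<iota> x))" "\<And>v w. g (\<iota> x) v w = g (\<iota> x) w v"
    and "smooth_subbundle B A \<iota> r (Rad B A g \<iota>)" "lightlike_transversal_bundle B A g \<iota> r S Str ltr"
  shows "dim (ltr x) = dim (Rad B A g \<iota> x)"
    and "n \<in> ltr x \<Longrightarrow> (\<And>\<xi>. \<xi> \<in> Rad B A g \<iota> x \<Longrightarrow> g (\<iota> x) n \<xi> = 0) \<Longrightarrow> n = 0"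
    and "\<xi> \<in> Rad B A g \<iota> x \<Longrightarrow> (\<And>n. n \<in> ltr x \<Longrightarrow> g (\<iota> x) \<xi> n = 0) \<Longrightarrow> \<xi> = 0"
    and "n \<in> ltr x \<Longrightarrow> n' \<in> ltr x \<Longrightarrow> g (\<iota> x) n n' = 0"
proof -
  obtain \<Omega> e N where frames: "x \<in> \<Omega>" "local_frame B A \<iota> r ltr \<Omega> N"
    and inj_e: "inj_on (\<lambda>i. e i x) {..<r}" and indep_e: "independent ((\<lambda>i. e i x) ` {..<r})"
    and span_e: "span ((\<lambda>i. e i x) ` {..<r}) = Rad B A g \<iota> x"
    and dual: "\<And>i j. i < r \<Longrightarrow> j < r \<Longrightarrow> g (\<iota> x) (e i x) (N j x) = (if i = j then 1 else 0)"
    and iso: "\<And>i j. i < r \<Longrightarrow> j < r \<Longrightarrow> g (\<iota> x) (N i x) (N j x) = 0"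
    using lightlike_transversal_frames[OF assms(3,4), of x] by metis
  let ?e = "\<lambda>i. e i x" and ?N = "\<lambda>i. N i x"
  have inj_N: "inj_on ?N {..<r}" and indep_N: "independent (?N ` {..<r})"
    and span_N: "span (?N ` {..<r}) = ltr x"
    using frames by (auto simp: local_frame_def)
  show "dim (ltr x) = dim (Rad B A g \<iota> x)"
    using indep_e indep_N inj_e inj_N
    by (simp add: span_e[symmetric] span_N[symmetric] dim_eq_card_independent card_image)
  show "n = 0" if "n \<in> ltr x" "\<And>\<xi>. \<xi> \<in> Rad B A g \<iota> x \<Longrightarrow> g (\<iota> x) n \<xi> = 0"
  proof (rule dual_frame_span_eq_0[OF g(1) _ inj_N])
    show "g (\<iota> x) (?N i) (?e j) = (if i = j then 1 else 0)" if "i < r" "j < r" for i j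
      using dual[OF that(2,1)] g(2)[of "?N i" "?e j"] by auto
    show "g (\<iota> x) n (?e j) = 0" if "j < r" for j
      using \<open>\<And>\<xi>. \<xi> \<in> Rad B A g \<iota> x \<Longrightarrow> g (\<iota> x) n \<xi> = 0\<close> that span_e by (auto intro: span_base)
  qed (use that span_e span_N in simp)
  show "\<xi> = 0" if "\<xi> \<in> Rad B A g \<iota> x" "\<And>n. n \<in> ltr x \<Longrightarrow> g (\<iota> x) \<xi> n = 0"
  proof (rule dual_frame_span_eq_0[OF g(1) dual inj_e])
    show "g (\<iota> x) \<xi> (?N j) = 0" if "j < r" for j
      using \<open>\<And>n. n \<in> ltr x \<Longrightarrow> g (\<iota> x) \<xi> n = 0\<close> that span_N by (auto intro: span_base)
  qed (use that span_e span_N in simp_all)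
  show "g (\<iota> x) n n' = 0" if n: "n \<in> ltr x" "n' \<in> ltr x"
  proof -
    have lin1: "linear (\<lambda>v. g (\<iota> x) v w)" and lin2: "linear (g (\<iota> x) v)" for v w
      using g(1) by (auto simp: bilinear_def)
    have "g (\<iota> x) (?N i) n' = 0" if "i < r" for i
      using linear_eq_0_on_span[OF lin2, of "?N ` {..<r}" "?N i" n'] iso[OF that] n(2) span_N by auto
    then show ?thesis
      using linear_eq_0_on_span[OF lin1, of "?N ` {..<r}" n' n] n(1) span_N by auto
  qed
qed


section \<open>Geodesic screen distributions\<close>

text \<open>
  The pointwise computation. In the application \<open>v\<close> is \<open>\<nabla>\<^sub>WU\<close>, whose components are \<open>t\<close>, \<open>l\<close>, \<open>z\<close>,
  and \<open>n\<close> is a vector of \<open>ltr\<close>. The identity \<open>J\<^sup>2 = p J + q\<close> turns \<open>b (J v) (J n)\<close> into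
  \<open>p b(v, J n) + q b(v, n)\<close>, and orthogonality leaves only the components shown.
\<close>

lemma metallic_transversal_component:
  fixes b :: "'e::real_vector \<Rightarrow> 'e \<Rightarrow> real"
  assumes b: "bilinear b"
    and J: "\<And>v. J (J v) = p *\<^sub>R J v + q *\<^sub>R v" "\<And>v w. b (J v) w = b v (J w)"
    and v: "v = t + l + z" and Jv: "J v = t' + l' + z'"
    and TJ: "b t (J n) = 0" "b t' (J n) = 0" and lJ: "b l (J n) = 0" "b l' (J n) = 0"
    and n: "b l n = 0" "b z n = 0"
  shows "b (z' - p *\<^sub>R z) (J n) = q * b t n"
proof -
  note bilin = bilinear_ladd[OF b] bilinear_radd[OF b] bilinear_lmul[OF b]
    bilinear_rmul[OF b] bilinear_lsub[OF b]
  have "b z' (J n) = b (J v) (J n)"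
    by (simp add: Jv bilin TJ lJ)
  also have "\<dots> = b v (J (J n))"
    by (rule J(2))
  also have "\<dots> = p * b z (J n) + q * b t n"
    by (simp add: J(1) v bilin TJ lJ n)
  finally show ?thesis
    by (simp add: bilin)
qed

text \<open>
  The identity behind the theorem: against \<open>J n\<close>, the vector \<open>\<nabla>\<^sup>s\<^sub>W JU - p h\<^sup>s(W, U)\<close> measures exactly
  \<open>q\<close> times the pairing of the induced derivative \<open>\<nabla>\<^sub>WU\<close> with \<open>n\<close>.
\<close>

lemma nabla_s_J_component:
  fixes A :: "('m::topological_space, 'e::euclidean_space) chart set"
    and B :: "('n::topological_space, 'f::euclidean_space) chart set"
  assumes M: "locally_metallic A g J p q nabla"
    and N: "lightlike_submanifold B A g \<iota> r"
    and S: "screen_distribution B A g \<iota> S"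
    and Str: "screen_transversal_bundle B A g \<iota> Str"
    and ltr: "lightlike_transversal_bundle B A g \<iota> r S Str ltr"
    and D: "pullback_connection B A \<iota> nabla D"
    and J_ltr: "J (\<iota> x) ` ltr x \<subseteq> Str x"
    and U: "smooth_along B A \<iota> UNIV U"
  shows "induced_deriv B A \<iota> D ltr Str W U x \<in> TN B A \<iota> x"
    and "n \<in> ltr x \<Longrightarrow> g (\<iota> x) (nabla_s B A \<iota> D ltr Str W (\<lambda>y. J (\<iota> y) (U y)) x
            - real p *\<^sub>R h_s B A \<iota> D ltr Str W U x) (J (\<iota> x) n) =
      real q * g (\<iota> x) (induced_deriv B A \<iota> D ltr Str W U x) n"
proof -
  let ?g = "g (\<iota> x)" and ?J = "J (\<iota> x)" and ?T = "TN B A \<iota> x" and ?P = "TN_perp B A g \<iota> x"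
  have metallic: "metallic_semi_riemannian A g J p q" and parallel: "parallel_endomorphism A nabla J"
    using M by (auto simp: locally_metallic_def)
  have atlas: "smooth_atlas A" and semi: "semi_riemannian_metric A g" and J: "\<And>m. linear (J m)"
      "\<And>m v. J m (J m v) = real p *\<^sub>R J m v + real q *\<^sub>R v" "\<And>m v w. g m (J m v) w = g m v (J m w)"
    using metallic by (simp_all add: metallic_semi_riemannian_def)
  have J_smooth: "smooth_vf_on A \<Omega> (\<lambda>m. J m (Y m))" if "open \<Omega>" "smooth_vf_on A \<Omega> Y" for \<Omega> Y
    using metallic that unfolding metallic_semi_riemannian_def by (elim conjE) simp
  have g: "\<And>m. bilinear (g m)" "\<And>m v w. g m v w = g m w v" "\<And>m. nondegenerate_on (g m) UNIV"
    using semi by (simp_all add: semi_riemannian_metric_def)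
  have imm: "smooth_atlas B" "smooth_map B A \<iota>" and Rad: "smooth_subbundle B A \<iota> r (Rad B A g \<iota>)"
    using N by (auto simp: lightlike_submanifold_def immersed_submanifold_def)
  interpret manifold_map B A \<iota>
    by unfold_locales fact+
  have subS: "subspace (S x)" and subStr: "subspace (Str x)"
    using S Str smooth_subbundle_subspace
    unfolding screen_distribution_def screen_transversal_bundle_def by blast+
  have subltr: "subspace (ltr x)"
    using lightlike_transversal_smooth_subbundle[OF Rad ltr] by (rule smooth_subbundle_subspace)
  have "is_direct_sum (Rad B A g \<iota> x) (S x) ?T"
    using S by (simp add: screen_distribution_def)
  \<comment> \<open>\<open>?T\<close> is a sum of two spans, hence a subspace\<close>
  then have subT: "subspace ?T"
    using subspace_sums[OF smooth_subbundle_subspace[OF Rad, of x] subS]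
    by (simp add: is_direct_sum_def)
  have Z: "is_direct_sum (?T \<inter> ?P) (Str x) ?P"
    using Str by (simp add: screen_transversal_bundle_def flip: Rad_def)
  have Str_P: "Str x \<subseteq> ?P"
  proof -
    have "0 \<in> ?T \<inter> ?P"
      using subspace_0[OF smooth_subbundle_subspace[OF Rad]] by (simp flip: Rad_def)
    then show ?thesis
      using Z unfolding is_direct_sum_def by force
  qed
  note duality = lightlike_transversal_duality[OF g(1,2) Rad ltr]
  have components: "t \<in> ?T \<and> l \<in> ltr x \<and> z \<in> Str x \<and> v = t + l + z"
    if "gw_components ?T (ltr x) (Str x) v = (t, l, z)" for v t l z
  proof -
    have P: "?P = {v. \<forall>u\<in>?T. ?g v u = 0}"
      by (simp add: TN_perp_def)
    have L: "dim (ltr x) = dim (?T \<inter> ?P)"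
      using duality(1) by (simp add: Rad_def)
    have L': "m = 0" if "m \<in> ltr x" "\<And>\<xi>. \<xi> \<in> ?T \<inter> ?P \<Longrightarrow> ?g m \<xi> = 0" for m
      using duality(2) that by (simp add: Rad_def)
    show ?thesis
      using gauss_weingarten_decomposition[OF g subT subltr subStr P Z L L' that] by blast
  qed
  define w where "w = inv (tangent_map B A \<iota> x) (W x)"
  define v where "v = D x w U"
  have Jv: "D x w (\<lambda>y. J (\<iota> y) (U y)) = ?J v"
    unfolding v_def by (rule pullback_connection_parallel[OF D parallel J(1) J_smooth open_UNIV UNIV_I U])
  obtain t l z where v_comp: "gw_components ?T (ltr x) (Str x) v = (t, l, z)"
    by (cases "gw_components ?T (ltr x) (Str x) v")
  obtain t' l' z' where Jv_comp: "gw_components ?T (ltr x) (Str x) (?J v) = (t', l', z')"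
    by (cases "gw_components ?T (ltr x) (Str x) (?J v)")
  note v = components[OF v_comp] and Jv' = components[OF Jv_comp]
  have ind: "induced_deriv B A \<iota> D ltr Str W U x = t"
    by (simp add: induced_deriv_def amb_deriv_def v_comp flip: w_def v_def)
  then show "induced_deriv B A \<iota> D ltr Str W U x \<in> TN B A \<iota> x"
    using v by blast
  have T_Str: "?g a b = 0" if "a \<in> ?T" "b \<in> Str x" for a b
    using that Str_P g(2)[of _ a b] by (auto simp: TN_perp_def)
  have ltr_Str: "?g a b = 0" if "a \<in> ltr x" "b \<in> Str x" for a b
    using ltr that unfolding lightlike_transversal_bundle_def orthogonal_sets_def by blast
  assume n: "n \<in> ltr x"
  then have Jn: "?J n \<in> Str x"
    using J_ltr by blast
  have "?g (z' - real p *\<^sub>R z) (?J n) = real q * ?g t n"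
  proof (rule metallic_transversal_component[where b = "?g" and J = "?J" and v = v and t = t and l = l
        and t' = t' and l' = l' and n = n])
    show "bilinear ?g" "\<And>v. ?J (?J v) = real p *\<^sub>R ?J v + real q *\<^sub>R v" "\<And>v w. ?g (?J v) w = ?g v (?J w)"
      by (rule g(1) J(2,3))+
    show "v = t + l + z" "?J v = t' + l' + z'"
      using v Jv' by blast+
    show "?g t (?J n) = 0" "?g t' (?J n) = 0"
      using v Jv' by (auto intro: T_Str[OF _ Jn])
    show "?g l (?J n) = 0" "?g l' (?J n) = 0"
      using v Jv' by (auto intro: ltr_Str[OF _ Jn])
    show "?g l n = 0"
      using v duality(4)[OF _ n] by blast
    show "?g z n = 0"
      using ltr_Str[OF n, of z] v g(2)[of _ z n] by simp
  qed
  then show "g (\<iota> x) (nabla_s B A \<iota> D ltr Str W (\<lambda>y. J (\<iota> y) (U y)) x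
            - real p *\<^sub>R h_s B A \<iota> D ltr Str W U x) (J (\<iota> x) n) =
      real q * g (\<iota> x) (induced_deriv B A \<iota> D ltr Str W U x) n"
    by (simp add: nabla_s_def h_s_def ind amb_deriv_def Jv v_comp Jv_comp flip: w_def v_def)
qed

lemma mem_screen_iff_orthogonal_ltr:
  assumes g: "bilinear (g (\<iota> x))" "\<And>v w. g (\<iota> x) v w = g (\<iota> x) w v"
    and Rad: "smooth_subbundle B A \<iota> r (Rad B A g \<iota>)"
    and S: "screen_distribution B A g \<iota> S"
    and ltr: "lightlike_transversal_bundle B A g \<iota> r S Str ltr"
    and a: "a \<in> TN B A \<iota> x"
  shows "a \<in> S x \<longleftrightarrow> (\<forall>n\<in>ltr x. g (\<iota> x) a n = 0)"
proof -
  have ltr_S: "g (\<iota> x) s n = 0" if "s \<in> S x" "n \<in> ltr x" for s n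
    using ltr that g(2)[of s n] unfolding lightlike_transversal_bundle_def orthogonal_sets_def by simp
  have "is_direct_sum (Rad B A g \<iota> x) (S x) (TN B A \<iota> x)"
    using S by (simp add: screen_distribution_def)
  then obtain \<rho> s where a_eq: "\<rho> \<in> Rad B A g \<iota> x" "s \<in> S x" "a = \<rho> + s"
    using a unfolding is_direct_sum_def by blast
  show ?thesis
  proof
    assume "\<forall>n\<in>ltr x. g (\<iota> x) a n = 0"
    then have "g (\<iota> x) \<rho> n = 0" if "n \<in> ltr x" for n
      using that ltr_S[OF a_eq(2)] by (simp add: a_eq(3) bilinear_ladd[OF g(1)])
    then have "\<rho> = 0"
      using lightlike_transversal_duality(3)[OF g Rad ltr a_eq(1)] by blast
    then show "a \<in> S x"
      using a_eq by simp
  qed (use ltr_S in blast)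
qed

theorem theorem3p12:
  fixes A :: "('m::{t2_space, second_countable_topology}, 'e::euclidean_space) chart set"
    and B :: "('n::{t2_space, second_countable_topology}, 'f::euclidean_space) chart set"
    and g :: "'m \<Rightarrow> 'e \<Rightarrow> 'e \<Rightarrow> real"
    and J :: "'m \<Rightarrow> 'e \<Rightarrow> 'e"
    and nabla :: "'m \<Rightarrow> 'e \<Rightarrow> ('m \<Rightarrow> 'e) \<Rightarrow> 'e"
    and \<iota> :: "'n \<Rightarrow> 'm"
    and D :: "'n \<Rightarrow> 'f \<Rightarrow> ('n \<Rightarrow> 'e) \<Rightarrow> 'e"
    and S Str ltr :: "'n \<Rightarrow> 'e set"
    and p q r :: nat
  assumes "p > 0" and "q > 0"
    and "locally_metallic A g J p q nabla"
    and "lightlike_submanifold B A g \<iota> r"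
    and "screen_distribution B A g \<iota> S"
    and "screen_transversal_bundle B A g \<iota> Str"
    and "lightlike_transversal_bundle B A g \<iota> r S Str ltr"
    and "pullback_connection B A \<iota> nabla D"
    and "screen_transversal_anti_invariant B A g J \<iota> S Str"
    and "screen_transversal_decomposition B A g J \<iota> S Str ltr"
  shows "screen_totally_geodesic_foliation B A \<iota> D S Str ltr \<longleftrightarrow>
    (\<forall>W \<in> sections B A \<iota> S. \<forall>U \<in> sections B A \<iota> S.
       no_component_in_J_ltr B A g J \<iota> ltr
         (\<lambda>x. nabla_s B A \<iota> D ltr Str W (\<lambda>y. J (\<iota> y) (U y)) x
              - real p *\<^sub>R h_s B A \<iota> D ltr Str W U x))"
proof -
  let ?nab = "induced_deriv B A \<iota> D ltr Str"
  note Rad = assms(4)[unfolded lightlike_submanifold_def, THEN conjunct2, THEN conjunct2,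
      THEN conjunct2, THEN conjunct2]
  have g: "bilinear (g m)" "g m v w = g m w v" for m v w
    using assms(3)
    by (auto simp: locally_metallic_def metallic_semi_riemannian_def semi_riemannian_metric_def)
  have map: "manifold_map B A \<iota>"
    using assms(3,4)
    by (auto simp: manifold_map_def locally_metallic_def metallic_semi_riemannian_def
        lightlike_submanifold_def immersed_submanifold_def)
  note sub_ltr = lightlike_transversal_smooth_subbundle[OF Rad assms(7)]
  have "(\<forall>x. ?nab W U x \<in> S x) \<longleftrightarrow> no_component_in_J_ltr B A g J \<iota> ltr
      (\<lambda>x. nabla_s B A \<iota> D ltr Str W (\<lambda>y. J (\<iota> y) (U y)) x
           - real p *\<^sub>R h_s B A \<iota> D ltr Str W U x)" (is "_ \<longleftrightarrow> ?no_comp")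
    if "U \<in> sections B A \<iota> S" for W U
  proof -
    have U: "smooth_along B A \<iota> UNIV U"
      using that by (simp add: sections_def)
    have "J (\<iota> x) ` ltr x \<subseteq> Str x" for x
      using assms(10) by (simp add: screen_transversal_decomposition_def)
    note comp = nabla_s_J_component[OF assms(3-8) this U, where W = W]
    have "?no_comp \<longleftrightarrow> (\<forall>N \<in> sections B A \<iota> ltr. \<forall>x. g (\<iota> x) (?nab W U x) (N x) = 0)"
      \<comment> \<open>the factor \<open>q\<close> cancels because it is positive\<close>
      using comp(2) assms(2) by (simp add: no_component_in_J_ltr_def sections_def)
    also have "\<dots> \<longleftrightarrow> (\<forall>x. \<forall>n\<in>ltr x. g (\<iota> x) (?nab W U x) n = 0)"
    proof
      assume *: "\<forall>N \<in> sections B A \<iota> ltr. \<forall>x. g (\<iota> x) (?nab W U x) (N x) = 0"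
      show "\<forall>x. \<forall>n\<in>ltr x. g (\<iota> x) (?nab W U x) n = 0"
        \<comment> \<open>every vector of the fibre is the value of a global section\<close>
        using * section_through[OF map sub_ltr] by metis
    qed (auto simp: sections_def)
    also have "\<dots> \<longleftrightarrow> (\<forall>x. ?nab W U x \<in> S x)"
    proof (rule all_cong1)
      fix x
      show "(\<forall>n\<in>ltr x. g (\<iota> x) (?nab W U x) n = 0) \<longleftrightarrow> ?nab W U x \<in> S x"
        using mem_screen_iff_orthogonal_ltr[OF g Rad assms(5,7) comp(1)] by blast
    qed
    finally show ?thesis ..
  qed
  then show ?thesis
    by (simp add: screen_totally_geodesic_foliation_def)
qed

end
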